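(* Let $\varphi:\mathbb{R}^n\to\mathbb{R}$ be smooth, set $V_1=\frac14|\nabla\varphi|^2-\frac12\triangle\varphi$ and $V_2=\frac14|\nabla\varphi|^2+\frac12\triangle\varphi$, and let $\mathbb{B}(x,r)$ denote the ball with center $x$ and radius $r$. (1) Suppose that $V_1\ge-C$ for some $C>0$. If the injection $H^1(\mathbb{R}^n,\varphi)\hookrightarrow L^2(\mathbb{R}^n,\varphi)$ is compact, then for any $r>0$ $$\int_{\mathbb{B}(x,r)}\left(\frac14|\nabla\varphi|^2-\frac12\triangle\varphi\right)d\lambda\to\infty\quad\text{as}\quad|x|\to\infty.$$ (2) Suppose that $V_2\ge-C$ for some $C>0$. If the injection $H^1(\mathbb{R}^n,\varphi,\nabla\varphi)\hookrightarrow L^2(\mathbb{R}^n,\varphi)$ is compact, then for any $r>0$ $$\int_{\mathbb{B}(x,r)}\left(\frac14|\nabla\varphi|^2+\frac12\triangle\varphi\right)d\lambda\to\infty\quad\text{as}\quad|x|\to\infty.$$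
   Context: $\lambda$ is Lebesgue measure. $L^2(\mathbb{R}^n,\varphi)$ is the space of measurable $f:\mathbb{R}^n\to\mathbb{C}$ with $\|f\|_\varphi^2=\int_{\mathbb{R}^n}|f|^2e^{-\varphi}\,d\lambda<\infty$. $H^1(\mathbb{R}^n,\varphi)$ is the space of $f\in L^2(\mathbb{R}^n,\varphi)$ with distributional derivatives $\frac{\partial f}{\partial x_j}\in L^2(\mathbb{R}^n,\varphi)$ for $1\le j\le n$, with norm $\|f\|_{1,\varphi}^2=\|f\|_\varphi^2+\sum_{j=1}^n\|\frac{\partial f}{\partial x_j}\|_\varphi^2$. With $X_j=\frac{\partial}{\partial x_j}-\frac{\partial\varphi}{\partial x_j}$ (the second term acting by multiplication), $H^1(\mathbb{R}^n,\varphi,\nabla\varphi)$ is the space of $f\in L^2(\mathbb{R}^n,\varphi)$ with $X_jf\in L^2(\mathbb{R}^n,\varphi)$ (in the sense of distributions) for $1\le j\le n$, with norm $\|f\|_{\varphi,\nabla\varphi}^2=\|f\|_\varphi^2+\sum_{j=1}^n\|X_jf\|_\varphi^2$. *)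

theory Defs
  imports "HOL-Analysis.Analysis"
begin

definition partial :: "'n \<Rightarrow> (real^'n::finite \<Rightarrow> 'b::real_normed_vector) \<Rightarrow> real^'n \<Rightarrow> 'b" where
  "partial j f x = frechet_derivative f (at x) (axis j 1)"

text \<open>Differentiability of every iterated partial derivative (\<open>js = []\<close> being the function
  itself) also makes all of them continuous, so this is \<open>C\<^sup>\<infinity>\<close>.\<close>

definition smooth :: "(real^'n::finite \<Rightarrow> 'b::real_normed_vector) \<Rightarrow> bool" where
  "smooth f \<longleftrightarrow> (\<forall>js x. foldr partial js f differentiable (at x))"

definition gradient :: "(real^'n::finite \<Rightarrow> real) \<Rightarrow> real^'n \<Rightarrow> real^'n" where
  "gradient f x = (\<chi> j. partial j f x)"

definition laplacian :: "(real^'n::finite \<Rightarrow> real) \<Rightarrow> real^'n \<Rightarrow> real" where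
  "laplacian f x = (\<Sum>j\<in>UNIV. partial j (partial j f) x)"

definition V1 :: "(real^'n::finite \<Rightarrow> real) \<Rightarrow> real^'n \<Rightarrow> real" where
  "V1 \<phi> x = 1/4 * (norm (gradient \<phi> x))\<^sup>2 - 1/2 * laplacian \<phi> x"

definition V2 :: "(real^'n::finite \<Rightarrow> real) \<Rightarrow> real^'n \<Rightarrow> real" where
  "V2 \<phi> x = 1/4 * (norm (gradient \<phi> x))\<^sup>2 + 1/2 * laplacian \<phi> x"

text \<open>The function spaces below are sets of functions rather than of almost-everywhere classes;
  the norms are seminorms that depend only on the class.\<close>

definition L2 :: "(real^'n::finite \<Rightarrow> real) \<Rightarrow> (real^'n \<Rightarrow> complex) set" where
  "L2 \<phi> = {f. f \<in> borel_measurable lebesgue \<and>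
               integrable lebesgue (\<lambda>x. (cmod (f x))\<^sup>2 * exp (- \<phi> x))}"

definition L2_norm :: "(real^'n::finite \<Rightarrow> real) \<Rightarrow> (real^'n \<Rightarrow> complex) \<Rightarrow> real" where
  "L2_norm \<phi> f = sqrt (LINT x|lebesgue. (cmod (f x))\<^sup>2 * exp (- \<phi> x))"

text \<open>A distribution is represented by its action on test functions; its values at other
  arguments are irrelevant.\<close>

type_synonym 'n distribution = "(real^'n \<Rightarrow> complex) \<Rightarrow> complex"

definition test_function :: "(real^'n::finite \<Rightarrow> complex) \<Rightarrow> bool" where
  "test_function \<eta> \<longleftrightarrow> smooth \<eta> \<and> compact (closure {x. \<eta> x \<noteq> 0})"

definition distr_of :: "(real^'n::finite \<Rightarrow> complex) \<Rightarrow> 'n distribution" where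
  "distr_of f \<eta> = (LINT x|lebesgue. f x * \<eta> x)"

definition distr_partial :: "'n \<Rightarrow> 'n::finite distribution \<Rightarrow> 'n distribution" where
  "distr_partial j T \<eta> = - T (partial j \<eta>)"

definition distr_mult :: "(real^'n::finite \<Rightarrow> real) \<Rightarrow> 'n distribution \<Rightarrow> 'n distribution" where
  "distr_mult a T \<eta> = T (\<lambda>x. complex_of_real (a x) * \<eta> x)"

definition distr_X ::
  "(real^'n::finite \<Rightarrow> real) \<Rightarrow> 'n \<Rightarrow> 'n distribution \<Rightarrow> 'n distribution" where
  "distr_X \<phi> j T \<eta> = distr_partial j T \<eta> - distr_mult (partial j \<phi>) T \<eta>"

definition represents :: "(real^'n::finite \<Rightarrow> complex) \<Rightarrow> 'n distribution \<Rightarrow> bool" where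
  "represents g T \<longleftrightarrow> (\<forall>\<eta>. test_function \<eta> \<longrightarrow> T \<eta> = distr_of g \<eta>)"

definition distr_in_L2 :: "(real^'n::finite \<Rightarrow> real) \<Rightarrow> 'n distribution \<Rightarrow> bool" where
  "distr_in_L2 \<phi> T \<longleftrightarrow> (\<exists>g\<in>L2 \<phi>. represents g T)"

text \<open>For continuous \<open>\<phi>\<close>, elements of \<open>L2 \<phi>\<close> are locally integrable, so the representing function
  is unique up to a null set and the norm does not depend on the choice.\<close>

definition distr_L2_norm :: "(real^'n::finite \<Rightarrow> real) \<Rightarrow> 'n distribution \<Rightarrow> real" where
  "distr_L2_norm \<phi> T = L2_norm \<phi> (SOME g. g \<in> L2 \<phi> \<and> represents g T)"

definition H1 :: "(real^'n::finite \<Rightarrow> real) \<Rightarrow> (real^'n \<Rightarrow> complex) set" where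
  "H1 \<phi> = {f \<in> L2 \<phi>. \<forall>j. distr_in_L2 \<phi> (distr_partial j (distr_of f))}"

definition H1_norm :: "(real^'n::finite \<Rightarrow> real) \<Rightarrow> (real^'n \<Rightarrow> complex) \<Rightarrow> real" where
  "H1_norm \<phi> f =
     sqrt ((L2_norm \<phi> f)\<^sup>2 + (\<Sum>j\<in>UNIV. (distr_L2_norm \<phi> (distr_partial j (distr_of f)))\<^sup>2))"

definition H1X :: "(real^'n::finite \<Rightarrow> real) \<Rightarrow> (real^'n \<Rightarrow> complex) set" where
  "H1X \<phi> = {f \<in> L2 \<phi>. \<forall>j. distr_in_L2 \<phi> (distr_X \<phi> j (distr_of f))}"

definition H1X_norm :: "(real^'n::finite \<Rightarrow> real) \<Rightarrow> (real^'n \<Rightarrow> complex) \<Rightarrow> real" where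
  "H1X_norm \<phi> f =
     sqrt ((L2_norm \<phi> f)\<^sup>2 + (\<Sum>j\<in>UNIV. (distr_L2_norm \<phi> (distr_X \<phi> j (distr_of f)))\<^sup>2))"

text \<open>The inclusion of \<open>E\<close> (seminorm \<open>nE\<close>) into \<open>F\<close> (seminorm \<open>nF\<close>) is a compact operator:
  every sequence bounded in \<open>E\<close> has a subsequence converging in \<open>F\<close>.\<close>

definition compact_injection ::
  "('a \<Rightarrow> complex) set \<Rightarrow> (('a \<Rightarrow> complex) \<Rightarrow> real) \<Rightarrow>
   ('a \<Rightarrow> complex) set \<Rightarrow> (('a \<Rightarrow> complex) \<Rightarrow> real) \<Rightarrow> bool" where
  "compact_injection E nE F nF \<longleftrightarrow> E \<subseteq> F \<and>
     (\<forall>u :: nat \<Rightarrow> 'a \<Rightarrow> complex. (\<forall>k. u k \<in> E) \<and> (\<exists>B. \<forall>k. nE (u k) \<le> B) \<longrightarrow>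
        (\<exists>v\<in>F. \<exists>s :: nat \<Rightarrow> nat. strict_mono s \<and>
           (\<lambda>k. nF (\<lambda>x. u (s k) x - v x)) \<longlonglongrightarrow> 0))"

end

theory Submission
  imports Defs
begin

text \<open>Let \<open>w\<close> be a fixed \<open>C\<^sup>1\<close> cutoff supported in the ball of radius \<open>r\<close> about \<open>0\<close>, and put
  \<open>u\<^sub>a = exp (\<phi> / 2) w(\<cdot> - a)\<close>. Then \<open>\<parallel>u\<^sub>a\<parallel>\<^sub>\<phi>\<close> does not depend on \<open>a\<close>, and integrating the mixed terms
  by parts gives
  \<open>\<Sum>\<^sub>j \<parallel>\<partial>\<^sub>j u\<^sub>a\<parallel>\<^sub>\<phi>\<^sup>2 = \<integral> |\<nabla>w|\<^sup>2 + \<integral> V1 w(\<cdot> - a)\<^sup>2\<close>, and the same with \<open>X\<^sub>j\<close> and \<open>V2\<close>.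
  If the integrals of the potential over \<open>ball a r\<close> did not tend to infinity, they would be bounded
  above along some \<open>a\<^sub>k \<rightarrow> \<infinity>\<close>; the lower bound on the potential then bounds \<open>u\<^bsub>a\<^sub>k\<^esub>\<close> in
  the first-order space, although functions of equal norm whose supports move to infinity have no
  convergent subsequence.\<close>

subsection \<open>Test functions and the fundamental lemma of the calculus of variations\<close>

lemma borel_measurable_if_continuous:
  fixes f :: "'a::euclidean_space \<Rightarrow> 'b::topological_space"
  assumes "continuous_on UNIV f"
  shows "f \<in> borel_measurable lebesgue"
  using borel_measurable_continuous_onI[OF assms]
  by (intro measurable_completion) simp

text \<open>Induction over the list of directions is done once here: to prove smoothness it is
  enough to exhibit a class of differentiable functions that is closed under partial
  derivatives.\<close>

lemma smooth_coinduct: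
  assumes "f \<in> S"
    and "\<And>g x. g \<in> S \<Longrightarrow> g differentiable (at x)"
    and "\<And>g j. g \<in> S \<Longrightarrow> partial j g \<in> S"
  shows "smooth f"
proof -
  have "foldr partial js f \<in> S" for js
    by (induction js) (use assms in auto)
  then show ?thesis
    using assms(2) by (auto simp: smooth_def)
qed

lemma smooth_partial: "smooth f \<Longrightarrow> smooth (partial j f)"
  unfolding smooth_def
proof (intro allI)
  fix js x
  assume "\<forall>js x. foldr partial js f differentiable at x"
  then have "foldr partial (js @ [j]) f differentiable at x" by blast
  then show "foldr partial js (partial j f) differentiable at x" by simp
qed

lemma smooth_differentiable: "smooth f \<Longrightarrow> f differentiable (at x)"
  unfolding smooth_def by (metis foldr.simps(1) id_apply)

lemma smooth_continuous_on: "smooth f \<Longrightarrow> continuous_on S f"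
  by (meson continuous_at_imp_continuous_on differentiable_imp_continuous_within smooth_differentiable)

lemma partial_eqI: "(f has_derivative f') (at x) \<Longrightarrow> partial j f x = f' (axis j 1)"
  by (simp add: partial_def frechet_derivative_at[symmetric])

section \<open>Flat functions of one variable and smooth products of them\<close>

text \<open>For \<open>m = 0\<close> this is the classical smooth function that is flat at 0. The
  powers \<open>s ^ m\<close> in the denominator make the family closed under differentiation, up to
  linear combinations.\<close>

definition flat :: "real \<Rightarrow> nat \<Rightarrow> real \<Rightarrow> real" where
  "flat c m s = (if s \<le> 0 then 0 else exp (- c / s) / s ^ m)"

text \<open>The term of order \<open>m + 2\<close> in the exponential series gives
  \<open>(c / s) ^ (m + 2) \<le> fact (m + 2) * exp (c / s)\<close>. Going two orders beyond the
  denominator leaves the factor \<open>s\<^sup>2\<close>, which makes the difference quotients at 0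
  tend to 0.\<close>

lemma flat_le_square:
  assumes "c > 0"
  shows "\<bar>flat c m s\<bar> \<le> fact (m + 2) / c ^ (m + 2) * s\<^sup>2"
proof (cases "s \<le> 0")
  case False
  then have s: "s > 0" by simp
  define n where "n = m + 2"
  define y where "y = c / s"
  have "(\<Sum>i\<in>{n}. y ^ i /\<^sub>R fact i) \<le> exp y"
    unfolding exp_def by (rule sum_le_suminf[OF summable_exp_generic]) (use s assms in \<open>auto simp: y_def\<close>)
  then have "(c / s) ^ n \<le> fact n * exp (c / s)"
    unfolding y_def[symmetric] by (simp add: field_simps)
  then have "c ^ n \<le> fact n * exp (c / s) * s ^ n"
    using s by (simp add: power_divide divide_le_eq)
  then have "exp (- c / s) * c ^ n \<le> exp (- c / s) * (fact n * exp (c / s) * s ^ n)"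
    by (intro mult_left_mono) auto
  also have "\<dots> = fact n * s ^ n"
    by (simp add: exp_minus)
  finally have "exp (- c / s) \<le> fact n / c ^ n * s ^ n"
    using assms by (simp add: field_simps)
  then have "exp (- c / s) / s ^ m \<le> fact n / c ^ n * s ^ n / s ^ m"
    using s by (intro divide_right_mono) auto
  also have "\<dots> = fact n / c ^ n * s\<^sup>2"
    using s by (simp add: n_def power_add power2_eq_square)
  finally show ?thesis
    using s by (simp add: flat_def n_def del: fact_Suc)
qed (use assms in \<open>simp add: flat_def\<close>)

text \<open>Off 0 the function agrees locally with an elementary expression. At 0 the quadratic
  bound forces the difference quotient to 0, which is the value of the right-hand side
  there.\<close>

lemma DERIV_flat:
  assumes "c > 0"
  shows "(flat c m has_real_derivative c * flat c (m + 2) s - real m * flat c (m + 1) s) (at s)"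
proof -
  consider "s < 0" | "s = 0" | "s > 0" by linarith
  then show ?thesis
  proof cases
    case 1
    have "((\<lambda>_. 0) has_real_derivative 0) (at s)" by simp
    then have "(flat c m has_real_derivative 0) (at s)"
      by (rule DERIV_cong_ev[THEN iffD1, rotated -1, OF _ refl _ refl])
         (use 1 in \<open>auto simp: flat_def intro!: eventually_mono[OF eventually_nhds_in_open[of "{..<0}"]]\<close>)
    then show ?thesis using 1 by (simp add: flat_def)
  next
    case 3
    have "((\<lambda>s. exp (- c / s) / s ^ m) has_real_derivative
        c * (exp (- c / s) / s ^ (m + 2)) - real m * (exp (- c / s) / s ^ (m + 1))) (at s)"
      using 3 by (auto intro!: derivative_eq_intros simp: field_simps power2_eq_square)
        (cases m; simp add: field_simps)
    then have "(flat c m has_real_derivative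
        c * (exp (- c / s) / s ^ (m + 2)) - real m * (exp (- c / s) / s ^ (m + 1))) (at s)"
      by (rule DERIV_cong_ev[THEN iffD1, rotated -1, OF _ refl _ refl])
         (use 3 in \<open>auto simp: flat_def intro!: eventually_mono[OF eventually_nhds_in_open[of "{0<..}"]]\<close>)
    then show ?thesis using 3 by (simp add: flat_def)
  next
    case 2
    define K where "K = fact (m + 2) / c ^ (m + 2)"
    have "(\<lambda>h. flat c m h / h) \<midarrow>0\<rightarrow> 0"
    proof (rule Lim_null_comparison)
      have "norm (flat c m h / h) \<le> K * \<bar>h\<bar>" if "h \<noteq> 0" for h
        using flat_le_square[OF assms, of m h] that
        unfolding K_def[symmetric] by (simp add: power2_eq_square divide_le_eq mult.assoc)
      then show "\<forall>\<^sub>F h in at 0. norm (flat c m h / h) \<le> K * \<bar>h\<bar>"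
        by (auto simp: eventually_at_filter)
      show "(\<lambda>h. K * \<bar>h\<bar>) \<midarrow>0\<rightarrow> 0"
        by (auto intro!: tendsto_eq_intros)
    qed
    then show ?thesis using 2 by (simp add: DERIV_def flat_def)
  qed
qed

text \<open>A class that contains polynomials inserted into \<open>flat\<close>. Being generated
  inductively, it can be shown closed under derivatives case by case.\<close>

inductive_set smooth_real :: "(real \<Rightarrow> real) set" where
  const: "(\<lambda>_. c) \<in> smooth_real"
| ident: "(\<lambda>t. t) \<in> smooth_real"
| add: "f \<in> smooth_real \<Longrightarrow> g \<in> smooth_real \<Longrightarrow> (\<lambda>t. f t + g t) \<in> smooth_real"
| mult: "f \<in> smooth_real \<Longrightarrow> g \<in> smooth_real \<Longrightarrow> (\<lambda>t. f t * g t) \<in> smooth_real"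
| flat: "f \<in> smooth_real \<Longrightarrow> c > 0 \<Longrightarrow> (\<lambda>t. flat c m (f t)) \<in> smooth_real"

lemma smooth_real_deriv:
  assumes "f \<in> smooth_real"
  obtains f' where "f' \<in> smooth_real" "\<And>t. (f has_real_derivative f' t) (at t)"
proof -
  have "\<exists>f'\<in>smooth_real. \<forall>t. (f has_real_derivative f' t) (at t)"
    using assms
  proof induction
    case (const c)
    show ?case by (intro bexI[of _ "\<lambda>_. 0"]) (auto intro: smooth_real.const)
  next
    case ident
    show ?case by (intro bexI[of _ "\<lambda>_. 1"]) (auto intro: smooth_real.const)
  next
    case (add f g)
    then obtain f' g' where "f' \<in> smooth_real" "g' \<in> smooth_real"
      "\<And>t. (f has_real_derivative f' t) (at t)" "\<And>t. (g has_real_derivative g' t) (at t)" by blast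
    then show ?case
      by (intro bexI[of _ "\<lambda>t. f' t + g' t"])
        (auto intro!: smooth_real.add derivative_intros)
  next
    case (mult f g)
    then obtain f' g' where "f' \<in> smooth_real" "g' \<in> smooth_real"
      "\<And>t. (f has_real_derivative f' t) (at t)" "\<And>t. (g has_real_derivative g' t) (at t)" by blast
    with mult show ?case
      by (intro bexI[of _ "\<lambda>t. f' t * g t + g' t * f t"])
        (auto intro!: smooth_real.add smooth_real.mult DERIV_mult)
  next
    case (flat f c m)
    then obtain f' where f': "f' \<in> smooth_real" "\<And>t. (f has_real_derivative f' t) (at t)"
      by blast
    show ?case
    proof (intro bexI allI)
      \<comment> \<open>The difference in the derivative of \<open>flat\<close> is written as a sum
        with the constant \<open>- real m\<close>, since the class is generated by sums and
        products.\<close>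
      show "(\<lambda>t. (c * flat c (m + 2) (f t) + - real m * flat c (m + 1) (f t)) * f' t) \<in> smooth_real"
        using flat f' by (intro smooth_real.intros)
      show "((\<lambda>t. flat c m (f t)) has_real_derivative
          (c * flat c (m + 2) (f t) + - real m * flat c (m + 1) (f t)) * f' t) (at t)" for t
        using DERIV_chain2[OF DERIV_flat[OF \<open>c > 0\<close>] f'(2)] by simp
    qed
  qed
  with that show ?thesis by blast
qed

text \<open>Differentiating in direction \<open>j\<close> replaces the factor of index
  \<open>j\<close> by its derivative and keeps the others, so products of one-variable factors form
  a class closed under partial derivatives.\<close>

lemma smooth_prod:
  fixes f :: "'n::finite \<Rightarrow> real \<Rightarrow> real"
  assumes "\<And>i. f i \<in> smooth_real"
  shows "smooth (\<lambda>x::real^'n. \<Prod>i\<in>UNIV. complex_of_real (f i (x $ i)))"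
proof (rule smooth_coinduct)
  let ?P = "\<lambda>f. (\<lambda>x::real^'n. \<Prod>i\<in>UNIV. complex_of_real (f i (x $ i)))"
  let ?S = "{?P f | f. \<forall>i. f i \<in> smooth_real}"
  show "?P f \<in> ?S" using assms by blast
  fix g assume "g \<in> ?S"
  then obtain f where g: "g = ?P f" and f: "\<And>i. f i \<in> smooth_real" by blast
  have "\<forall>i. \<exists>f'. f' \<in> smooth_real \<and> (\<forall>t. (f i has_real_derivative f' t) (at t))"
    using smooth_real_deriv[OF f] by metis
  then obtain f' where f': "\<And>i. f' i \<in> smooth_real" "\<And>i t. (f i has_real_derivative f' i t) (at t)"
    by metis
  have d: "(g has_derivative (\<lambda>y. \<Sum>i\<in>UNIV. complex_of_real (f' i (x $ i) * y $ i) *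
      (\<Prod>k\<in>UNIV - {i}. complex_of_real (f k (x $ k))))) (at x)" for x
    unfolding g
  proof (intro has_derivative_prod has_derivative_of_real)
    fix i
    have "((\<lambda>x::real^'n. x $ i) has_derivative (\<lambda>y. y $ i)) (at x)"
      by (rule bounded_linear.has_derivative[OF bounded_linear_vec_nth has_derivative_ident])
    then show "((\<lambda>x. f i (x $ i)) has_derivative (\<lambda>y. f' i (x $ i) * y $ i)) (at x)"
      using f'(2)[of i "x $ i"] has_derivative_compose 
      unfolding has_field_derivative_def by blast
  qed
  show "g differentiable (at x)" for x
    using d by (auto simp: differentiable_def)
  fix j
  have "partial j g x = ?P (f(j := f' j)) x" for x
  proof -
    have "partial j g x = (\<Sum>i\<in>UNIV. if i = j then complex_of_real (f' i (x $ i)) *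
      (\<Prod>k\<in>UNIV - {i}. complex_of_real (f k (x $ k))) else 0)"
      unfolding partial_eqI[OF d] by (intro sum.cong) (auto simp: axis_def)
    also have "\<dots> = complex_of_real (f' j (x $ j)) * (\<Prod>k\<in>UNIV - {j}. complex_of_real (f k (x $ k)))"
      by simp
    also have "\<dots> = ?P (f(j := f' j)) x"
      by (subst prod.remove[of UNIV j]) (auto intro!: prod.cong)
    finally show ?thesis .
  qed
  then have "partial j g = ?P (f(j := f' j))" by auto
  moreover have "\<forall>i. (f(j := f' j)) i \<in> smooth_real"
    using f f' by simp
  ultimately show "partial j g \<in> ?S" by blast
qed

text \<open>Letting \<open>c = 1 / Suc k\<close> tend to \<open>0\<close> makes these test functions converge to the indicator
  function of \<open>box a b\<close>.\<close>

definition box_bump :: "real^'n::finite \<Rightarrow> real^'n \<Rightarrow> nat \<Rightarrow> real^'n \<Rightarrow> complex" where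
  "box_bump a b k x =
    (\<Prod>i\<in>UNIV. complex_of_real (flat (1 / Suc k) 0 ((x $ i - a $ i) * (b $ i - x $ i))))"

lemma box_bump_factor_pos_iff:
  fixes a b t :: real
  assumes "a < b"
  shows "(t - a) * (b - t) \<le> 0 \<longleftrightarrow> \<not> (a < t \<and> t < b)"
  using assms by (auto simp: mult_le_0_iff)

lemma box_bump_eq_0:
  assumes "box a b \<noteq> {}" "x \<notin> box a b"
  shows "box_bump a b k x = 0"
proof -
  have "a $ i < b $ i" for i using assms(1) by (simp add: interval_ne_empty_cart)
  then show ?thesis
    using assms(2) by (force simp: box_bump_def mem_box_cart flat_def box_bump_factor_pos_iff)
qed

lemma norm_box_bump_le: "norm (box_bump a b k x) \<le> 1"
  unfolding box_bump_def prod_norm[symmetric]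
  by (rule prod_le_1) (auto simp: flat_def)

lemma box_bump_tendsto:
  assumes "x \<in> box a b"
  shows "(\<lambda>k. box_bump a b k x) \<longlonglongrightarrow> 1"
proof -
  have "(\<lambda>k. complex_of_real (flat (1 / Suc k) 0 ((x $ i - a $ i) * (b $ i - x $ i)))) \<longlonglongrightarrow> 1" for i
  proof -
    define s where "s = (x $ i - a $ i) * (b $ i - x $ i)"
    have "s > 0" using assms by (simp add: s_def mem_box_cart)
    have "(\<lambda>k. exp (- (inverse (real (Suc k))) / s)) \<longlonglongrightarrow> exp (- 0 / s)"
      by (intro tendsto_intros LIMSEQ_inverse_real_of_nat) (use \<open>s > 0\<close> in auto)
    then have "(\<lambda>k. complex_of_real (exp (- (inverse (real (Suc k))) / s))) \<longlonglongrightarrow> of_real 1"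
      by (intro tendsto_of_real) simp
    then show ?thesis
      unfolding s_def[symmetric] using \<open>s > 0\<close> by (simp add: flat_def divide_inverse)
  qed
  then have "(\<lambda>k. box_bump a b k x) \<longlonglongrightarrow> (\<Prod>i\<in>(UNIV::'a set). 1)"
    unfolding box_bump_def by (intro tendsto_prod)
  then show ?thesis by simp
qed

lemma smooth_box_bump: "smooth (box_bump a b k)"
proof -
  have "(\<lambda>t. flat (1 / Suc k) 0 ((t + - (a $ i)) * (b $ i + (- 1) * t))) \<in> smooth_real" for i
    by (intro smooth_real.intros) auto
  then have "smooth (\<lambda>x. \<Prod>i\<in>UNIV. complex_of_real
      (flat (1 / Suc k) 0 ((x $ i + - (a $ i)) * (b $ i + (- 1) * x $ i))))"
    by (rule smooth_prod)
  then show ?thesis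
    by (simp add: box_bump_def[abs_def])
qed

lemma test_function_box_bump:
  assumes "box a b \<noteq> {}"
  shows "test_function (box_bump a b k)"
proof -
  have "{x. box_bump a b k x \<noteq> 0} \<subseteq> cbox a b"
    using box_bump_eq_0[OF assms] box_subset_cbox by blast
  then have "bounded {x. box_bump a b k x \<noteq> 0}"
    using bounded_cbox bounded_subset by blast
  then show ?thesis
    by (simp add: test_function_def smooth_box_bump)
qed

section \<open>Functions with vanishing integrals over boxes or against test functions\<close>

lemma sigma_finite_lebesgue: "sigma_finite_measure (lebesgue :: 'a::euclidean_space measure)"
proof
  obtain A :: "'a set set" where "countable A" "A \<subseteq> sets lborel" "\<Union>A = space lborel"
    "\<forall>a\<in>A. emeasure lborel a \<noteq> \<infinity>"
    using lborel.sigma_finite_countable by blast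
  then show "\<exists>A. countable A \<and> A \<subseteq> sets lebesgue \<and> \<Union>A = space (lebesgue :: 'a measure) \<and>
      (\<forall>a\<in>A. emeasure lebesgue a \<noteq> \<infinity>)"
    by (intro exI[of _ A]) (auto simp: subset_iff)
qed

text \<open>Open boxes are stable under intersection and generate the Borel sets, so induction over
  the generated sigma-algebra carries vanishing integrals to all Borel sets. Lebesgue sets differ
  from these by null sets, and a density whose integrals all vanish is 0 almost everywhere.\<close>

lemma AE_eq_0_if_box_integrals_eq_0:
  fixes f :: "'a::euclidean_space \<Rightarrow> 'b::{banach, second_countable_topology}"
  assumes f: "integrable lebesgue f"
    and supp: "\<And>x. x \<notin> box c d \<Longrightarrow> f x = 0"
    and box: "\<And>a b. (LINT x:box a b|lebesgue. f x) = 0"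
  shows "AE x in lebesgue. f x = 0"
proof -
  have si: "set_integrable lebesgue A f" if "A \<in> sets lebesgue" for A
    unfolding set_integrable_def by (rule integrable_mult_indicator[OF that f])
  have borel: "(LINT x:A|lebesgue. f x) = 0" if "A \<in> sets borel" for A
  proof -
    have "Int_stable (range (\<lambda>(a, b). box a b :: 'a set))"
      by (auto simp: Int_stable_def box_Int_box)
    moreover have "range (\<lambda>(a, b). box a b :: 'a set) \<subseteq> Pow UNIV" by auto
    moreover have "A \<in> sigma_sets UNIV (range (\<lambda>(a, b). box a b))"
      using that unfolding borel_eq_box by simp
    ultimately show ?thesis
    proof (induction rule: sigma_sets_induct_disjoint)
      case (basic A)
      then show ?case using box by auto
    next
      case empty
      then show ?case by (simp add: set_lebesgue_integral_def)
    next
      case (compl A)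
      then have "A \<in> sets borel" by (simp add: borel_eq_box)
      then have A: "A \<in> sets lebesgue" by simp
      have "(LINT x:UNIV - A|lebesgue. f x) + (LINT x:A|lebesgue. f x) =
          (LINT x:(UNIV - A) \<union> A|lebesgue. f x)"
        by (rule set_integral_Un[symmetric]) (use A si sets.compl_sets[OF A] in auto)
      \<comment> \<open>The integral over the whole space is one over a single box because
        \<open>f\<close> is 0 off \<open>box c d\<close>. It therefore vanishes, and the integral
        over the complement of \<open>A\<close> vanishes with the one over \<open>A\<close>.\<close>
      also have "\<dots> = (LINT x:box c d|lebesgue. f x)"
        unfolding set_lebesgue_integral_def using supp
        by (intro Bochner_Integration.integral_cong) (auto simp: indicator_def)
      finally show ?case using compl(2) box[of c d] by simp
    next
      case (union F)
      then have "F i \<in> sets borel" for i by (auto simp: borel_eq_box)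
      then have F: "F i \<in> sets lebesgue" for i by simp
      have "(LINT x:(\<Union>i. F i)|lebesgue. f x) = (\<Sum>i. (LINT x:F i|lebesgue. f x))"
        using union F by (intro lebesgue_integral_countable_add si) (auto simp: disjoint_family_on_def)
      then show ?case using union by simp
    qed
  qed
  have "(LINT x:A|lebesgue. f x) = 0" if "A \<in> sets lebesgue" for A
  proof -
    obtain S N N' where "A = S \<union> N" "N \<subseteq> N'" "N' \<in> null_sets lborel" "S \<in> sets lborel"
      using sets_completionE[OF \<open>A \<in> sets lebesgue\<close>] by metis
    have "(LINT x:A|lebesgue. f x) = (LINT x:S|lebesgue. f x)"
    proof (rule set_integral_cong_set)
      show "set_borel_measurable lebesgue A f" "set_borel_measurable lebesgue S f"
        using si that \<open>S \<in> sets lborel\<close>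
        by (auto simp: set_borel_measurable_def set_integrable_def sets_completionI_sets 
            intro!: borel_measurable_integrable)
      have "AE x in lebesgue. x \<notin> N'"
        using \<open>N' \<in> null_sets lborel\<close> by (intro AE_completion AE_not_in)
      then show "AE x in lebesgue. (x \<in> S) = (x \<in> A)"
        using \<open>A = S \<union> N\<close> \<open>N \<subseteq> N'\<close> by (auto elim!: eventually_mono)
    qed
    then show ?thesis using borel \<open>S \<in> sets lborel\<close> by simp
  qed
  then show ?thesis
    using sigma_finite_measure.density_zero[OF sigma_finite_lebesgue f] by blast
qed

text \<open>Testing against \<open>box_bump a b k\<close> and letting \<open>k\<close> tend to
  infinity shows that the integral of \<open>g\<close> over each box is 0, which reduces the claim
  to the preceding criterion.\<close>

lemma AE_eq_0_if_test_function_integrals_eq_0: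
  fixes g :: "real^'n::finite \<Rightarrow> complex"
  assumes int: "\<And>a b. set_integrable lebesgue (box a b) g"
    and test: "\<And>\<eta>. test_function \<eta> \<Longrightarrow> (LINT x|lebesgue. g x * \<eta> x) = 0"
  shows "AE x in lebesgue. g x = 0"
proof -
  have box: "(LINT x:box a b|lebesgue. g x) = 0" for a b
  proof (cases "box a b = {}")
    case False
    have "(\<lambda>k. LINT x|lebesgue. g x * box_bump a b k x) \<longlonglongrightarrow> (LINT x:box a b|lebesgue. g x)"
      unfolding set_lebesgue_integral_def
    proof (rule integral_dominated_convergence)
      \<comment> \<open>The bumps have modulus at most 1 and vanish off the box, so \<open>g\<close>
        restricted to the box dominates.\<close>
      show "integrable lebesgue (\<lambda>x. norm (indicator (box a b) x *\<^sub>R g x))"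
        using int unfolding set_integrable_def by (rule integrable_norm)
      show g: "(\<lambda>x. indicator (box a b) x *\<^sub>R g x) \<in> borel_measurable lebesgue"
        using int unfolding set_integrable_def by (rule borel_measurable_integrable)
      have eq: "g x * box_bump a b k x = (indicator (box a b) x *\<^sub>R g x) * box_bump a b k x" for k x
        using box_bump_eq_0[OF False] by (auto simp: indicator_def)
      have m: "box_bump a b k \<in> borel_measurable lebesgue" for k
        by (intro borel_measurable_if_continuous smooth_continuous_on smooth_box_bump)
      show "(\<lambda>x. g x * box_bump a b k x) \<in> borel_measurable lebesgue" for k
        unfolding eq by (intro borel_measurable_times g m)
      show "AE x in lebesgue. (\<lambda>k. g x * box_bump a b k x) \<longlonglongrightarrow> indicator (box a b) x *\<^sub>R g x"
      proof (intro AE_I2)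
        fix x
        show "(\<lambda>k. g x * box_bump a b k x) \<longlonglongrightarrow> indicator (box a b) x *\<^sub>R g x"
          using tendsto_mult[OF tendsto_const box_bump_tendsto, of x a b "g x"] box_bump_eq_0[OF False]
          by (cases "x \<in> box a b") auto
      qed
      show "AE x in lebesgue. norm (g x * box_bump a b k x) \<le> norm (indicator (box a b) x *\<^sub>R g x)" for k
        unfolding eq norm_mult 
        by (intro AE_I2 mult_left_le norm_box_bump_le) auto
    qed
    then show ?thesis
      using test[OF test_function_box_bump[OF False]] by (simp add: LIMSEQ_const_iff)
  qed (simp add: set_lebesgue_integral_def)
  \<comment> \<open>\<open>g\<close> is integrable only over boxes, so it is truncated to the cubes
    of half-side \<open>k\<close>; these exhaust the space.\<close>
  have "AE x in lebesgue. indicator (box (- (\<chi> i. real k)) (\<chi> i. real k)) x *\<^sub>R g x = 0" for k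
  proof (rule AE_eq_0_if_box_integrals_eq_0)
    let ?B = "box (- (\<chi> i. real k)) (\<chi> i. real k) :: (real^'n) set"
    show "integrable lebesgue (\<lambda>x. indicator ?B x *\<^sub>R g x)"
      using int unfolding set_integrable_def .
    show "indicator ?B x *\<^sub>R g x = 0" if "x \<notin> ?B" for x
      using that by simp
    show "(LINT x:box a b|lebesgue. indicator ?B x *\<^sub>R g x) = 0" for a b
    proof -
      obtain a' b' where ab: "box a b \<inter> ?B = box a' b'"
        using box_Int_box by blast
      have "(LINT x:box a b|lebesgue. indicator ?B x *\<^sub>R g x) = (LINT x:box a' b'|lebesgue. g x)"
        unfolding set_lebesgue_integral_def ab[symmetric]
        by (intro Bochner_Integration.integral_cong) (auto simp: indicator_def)
      then show ?thesis using box by simp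
    qed
  qed
  then have "AE x in lebesgue. \<forall>k. indicator (box (- (\<chi> i. real k)) (\<chi> i. real k)) x *\<^sub>R g x = 0"
    by (subst AE_all_countable) blast
  then show ?thesis
  proof (rule eventually_mono)
    fix x :: "real^'n"
    assume *: "\<forall>k. indicator (box (- (\<chi> i. real k)) (\<chi> i. real k)) x *\<^sub>R g x = 0"
    obtain k where "norm x < real k" using reals_Archimedean2 by blast
    then have "\<bar>x $ i\<bar> < real k" for i
      using component_le_norm_cart[of x i] by linarith
    then have "x \<in> box (- (\<chi> i. real k)) (\<chi> i. real k)"
      by (simp add: mem_box_cart abs_less_iff) (smt (verit))
    then show "g x = 0" using * by (metis indicator_simps(1) scaleR_one)
  qed
qed

subsection \<open>Integration by parts\<close>

lemma integrable_if_compact_support: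
  fixes f :: "'a::euclidean_space \<Rightarrow> 'b::{banach, second_countable_topology}"
  assumes "continuous_on UNIV f" "\<And>x. x \<notin> cball a R \<Longrightarrow> f x = 0"
  shows "integrable lebesgue f"
proof -
  have "integrable lborel (\<lambda>x. indicator (cball a R) x *\<^sub>R f x)"
    by (intro borel_integrable_compact continuous_on_subset[OF assms(1)]) auto
  moreover have "(\<lambda>x. indicator (cball a R) x *\<^sub>R f x) = f"
    using assms(2) by (auto simp: indicator_def)
  ultimately show ?thesis
    using integrable_completion borel_measurable_integrable by metis
qed

lemma lebesgue_integral_shift:
  fixes f :: "'a::euclidean_space \<Rightarrow> 'b::{banach, second_countable_topology}"
  assumes "continuous_on UNIV f"
  shows "(LINT x|lebesgue. f (x + a)) = (LINT x|lebesgue. f x)"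
proof -
  have f: "f \<in> borel_measurable borel"
    using assms by (rule borel_measurable_continuous_onI)
  have "(LINT x|lborel. f x) = (LINT x|distr lborel borel ((+) a). f x)"
    by (simp add: lborel_distr_plus)
  also have "\<dots> = (LINT x|lborel. f (x + a))"
    using f by (subst integral_distr) (auto simp: add.commute)
  finally show ?thesis
    using f by (simp add: integral_completion measurable_compose)
qed

section \<open>Calculus of continuously differentiable functions\<close>

text \<open>Integration by parts is carried out in this class rather than for \<open>smooth\<close>
  functions, because the cutoffs below are in general not twice differentiable.\<close>

definition C1 :: "(real^'n::finite \<Rightarrow> 'b::real_normed_vector) \<Rightarrow> bool" where
  "C1 f \<longleftrightarrow> (\<forall>x. f differentiable (at x)) \<and> (\<forall>j. continuous_on UNIV (partial j f))"

lemma C1_has_derivative: "C1 f \<Longrightarrow> (f has_derivative frechet_derivative f (at x)) (at x)"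
  by (simp add: C1_def frechet_derivative_works)

lemma C1_continuous_on: "C1 f \<Longrightarrow> continuous_on S f"
  by (meson C1_def continuous_at_imp_continuous_on differentiable_imp_continuous_within)

lemma C1_continuous_on_partial: "C1 f \<Longrightarrow> continuous_on S (partial j f)"
  by (meson C1_def continuous_on_subset subset_UNIV)

lemma C1_if_smooth: "smooth f \<Longrightarrow> C1 f"
  by (simp add: C1_def smooth_continuous_on smooth_differentiable smooth_partial)

lemma C1I:
  assumes "\<And>x. (f has_derivative f' x) (at x)" "\<And>j. continuous_on UNIV (\<lambda>x. f' x (axis j 1))"
  shows "C1 f"
  using assms by (auto simp: C1_def differentiable_def partial_eqI[OF assms(1), abs_def])

lemma has_derivative_mult_C1:
  fixes f g :: "real^'n::finite \<Rightarrow> 'b::real_normed_algebra"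
  assumes "C1 f" "C1 g"
  shows "((\<lambda>x. f x * g x) has_derivative
    (\<lambda>h. f x * frechet_derivative g (at x) h + frechet_derivative f (at x) h * g x)) (at x)"
  using assms by (intro has_derivative_mult C1_has_derivative)

lemma partial_mult:
  fixes f g :: "real^'n::finite \<Rightarrow> 'b::real_normed_algebra"
  assumes "C1 f" "C1 g"
  shows "partial j (\<lambda>x. f x * g x) x = f x * partial j g x + partial j f x * g x"
  using partial_eqI[OF has_derivative_mult_C1[OF assms]] by (simp add: partial_def)

lemma C1_mult:
  fixes f g :: "real^'n::finite \<Rightarrow> 'b::real_normed_algebra"
  assumes "C1 f" "C1 g"
  shows "C1 (\<lambda>x. f x * g x)"
proof (rule C1I[OF has_derivative_mult_C1[OF assms]])
  fix j
  show "continuous_on UNIV (\<lambda>x. f x * frechet_derivative g (at x) (axis j 1)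
      + frechet_derivative f (at x) (axis j 1) * g x)"
    unfolding partial_def[symmetric]
    by (intro continuous_intros C1_continuous_on C1_continuous_on_partial assms)
qed

lemma
  assumes "C1 f"
  shows C1_of_real: "C1 (\<lambda>x. complex_of_real (f x))"
    and partial_of_real: "partial j (\<lambda>x. complex_of_real (f x)) x = of_real (partial j f x)"
proof -
  have d: "((\<lambda>x. complex_of_real (f x)) has_derivative
      (\<lambda>h. of_real (frechet_derivative f (at x) h))) (at x)" for x
    using C1_has_derivative[OF assms] by (rule has_derivative_of_real)
  show "C1 (\<lambda>x. complex_of_real (f x))"
    by (rule C1I[OF d]) (intro continuous_intros C1_continuous_on_partial[OF assms, unfolded partial_def])
  show "partial j (\<lambda>x. complex_of_real (f x)) x = of_real (partial j f x)"
    using partial_eqI[OF d] by (simp add: partial_def)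
qed

lemma
  fixes f :: "real^'n::finite \<Rightarrow> real"
  assumes "C1 f"
  shows C1_exp: "C1 (\<lambda>x. exp (c * f x))"
    and partial_exp: "partial j (\<lambda>x. exp (c * f x)) x = c * partial j f x * exp (c * f x)"
proof -
  have d: "((\<lambda>x. exp (c * f x)) has_derivative
      (\<lambda>h. c * frechet_derivative f (at x) h * exp (c * f x))) (at x)" for x
    using C1_has_derivative[OF assms] by (auto intro!: derivative_eq_intros)
  show "C1 (\<lambda>x. exp (c * f x))"
    by (rule C1I[OF d])
      (intro continuous_intros C1_continuous_on assms C1_continuous_on_partial[OF assms, unfolded partial_def])
  show "partial j (\<lambda>x. exp (c * f x)) x = c * partial j f x * exp (c * f x)"
    using partial_eqI[OF d] by (simp add: partial_def)
qed

text \<open>Translation invariance makes the integral of every difference quotient vanish.\<close>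

lemma integral_partial_eq_0:
  fixes f :: "real^'n::finite \<Rightarrow> 'b::{banach, second_countable_topology}"
  assumes f: "C1 f" and supp: "\<And>x. x \<notin> cball a R \<Longrightarrow> f x = 0"
  shows "(LINT x|lebesgue. partial j f x) = 0"
proof -
  define e :: "real^'n" where "e = axis j 1"
  have [simp]: "norm e = 1" by (simp add: e_def)
  define h where "h k = inverse (real (Suc k))" for k
  have h: "0 < h k" "h k \<le> 1" for k by (auto simp: h_def field_simps)
  define D where "D k x = (1 / h k) *\<^sub>R (f (x + h k *\<^sub>R e) - f x)" for k x
  have cf: "continuous_on UNIV f" using f by (rule C1_continuous_on)
  have cp: "continuous_on UNIV (partial j f)" using f by (rule C1_continuous_on_partial)
  have cs: "continuous_on UNIV (\<lambda>x. f (x + h k *\<^sub>R e))" for k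
    by (rule continuous_on_compose2[OF cf]) (auto intro!: continuous_intros)
  \<comment> \<open>Since \<open>h k \<le> 1\<close>, the difference quotients vanish off the ball
    of radius \<open>R + 1\<close>, and segments of length at most 1 that start in that ball stay
    within radius \<open>R + 2\<close>. The bound \<open>M\<close> of the derivative there dominates
    all quotients by the mean value inequality.\<close>
  have "compact (partial j f ` cball a (R + 2))"
    by (intro compact_continuous_image continuous_on_subset[OF cp]) auto
  then obtain M where M: "\<And>x. x \<in> cball a (R + 2) \<Longrightarrow> norm (partial j f x) \<le> M"
    by (meson compact_imp_bounded bounded_iff imageI)
  have line: "((\<lambda>t. f (x + t *\<^sub>R e)) has_vector_derivative partial j f (x + t *\<^sub>R e)) (at t within S)" for x t S
  proof -
    have "((\<lambda>t. x + t *\<^sub>R e) has_derivative (\<lambda>s. s *\<^sub>R e)) (at t within S)"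
      by (auto intro!: derivative_eq_intros)
    from has_derivative_compose[OF this C1_has_derivative[OF f]]
    have d: "((\<lambda>t. f (x + t *\<^sub>R e)) has_derivative
        (\<lambda>s. frechet_derivative f (at (x + t *\<^sub>R e)) (s *\<^sub>R e))) (at t within S)" .
    have "linear (frechet_derivative f (at (x + t *\<^sub>R e)))"
      using C1_has_derivative[OF f] has_derivative_linear by blast
    then show ?thesis
      using d by (simp add: has_vector_derivative_def partial_def e_def linear_scale)
  qed
  have out: "D k x = 0" if "x \<notin> cball a (R + 1)" for k x
  proof -
    have "dist a x \<le> dist a (x + h k *\<^sub>R e) + norm (h k *\<^sub>R e)"
      by (metis add_diff_cancel_left' dist_norm dist_triangle dist_commute)
    then have "x + h k *\<^sub>R e \<notin> cball a R" "x \<notin> cball a R"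
      using that h[of k] by auto
    then show ?thesis using supp by (simp add: D_def)
  qed
  have bound: "norm (D k x) \<le> indicator (cball a (R + 1)) x * M" for k x
  proof (cases "x \<in> cball a (R + 1)")
    case True
    have "norm (f (x + h k *\<^sub>R e) - f (x + 0 *\<^sub>R e)) \<le> M * norm (h k - 0)"
    proof (rule differentiable_bound[where S = "{0..1}"])
      fix t :: real assume t: "t \<in> {0..1}"
      show "((\<lambda>t. f (x + t *\<^sub>R e)) has_derivative (\<lambda>s. s *\<^sub>R partial j f (x + t *\<^sub>R e))) (at t within {0..1})"
        using line by (simp add: has_vector_derivative_def)
      have "dist a (x + t *\<^sub>R e) \<le> dist a x + dist x (x + t *\<^sub>R e)" by (rule dist_triangle)
      moreover have "dist x (x + t *\<^sub>R e) = t" using t by (simp add: dist_norm)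
      ultimately have "norm (partial j f (x + t *\<^sub>R e)) \<le> M"
        using t True by (intro M) auto
      then show "onorm (\<lambda>s. s *\<^sub>R partial j f (x + t *\<^sub>R e)) \<le> M"
        by (intro onorm_le) (simp add: mult.commute[of M] mult_left_mono)
    qed (use h[of k] in auto)
    then show ?thesis
      using True h[of k] by (simp add: D_def divide_le_eq del: scaleR_diff_right scaleR_right_diff_distrib)
  qed (simp add: out)
  have int0: "(LINT x|lebesgue. D k x) = 0" for k
  proof -
    have "integrable lebesgue f"
      using cf supp by (rule integrable_if_compact_support)
    moreover have "integrable lebesgue (\<lambda>x. f (x + h k *\<^sub>R e))"
    proof (rule integrable_if_compact_support[OF cs, of "a - h k *\<^sub>R e" R])
      fix x assume "x \<notin> cball (a - h k *\<^sub>R e) R"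
      then have "x + h k *\<^sub>R e \<notin> cball a R" by (simp add: dist_norm algebra_simps)
      then show "f (x + h k *\<^sub>R e) = 0" by (rule supp)
    qed
    ultimately show ?thesis
      unfolding D_def using lebesgue_integral_shift[OF cf, of "h k *\<^sub>R e"] by simp
  qed
  have "(\<lambda>k. LINT x|lebesgue. D k x) \<longlonglongrightarrow> (LINT x|lebesgue. partial j f x)"
  proof (rule integral_dominated_convergence)
    show "integrable lebesgue (\<lambda>x. indicator (cball a (R + 1)) x * M)"
      by (intro integrable_mult_left integrable_real_indicator)
        (auto simp: emeasure_bounded_finite[simplified])
    show "partial j f \<in> borel_measurable lebesgue"
      using cp by (rule borel_measurable_if_continuous)
    show "D k \<in> borel_measurable lebesgue" for k
      unfolding D_def by (intro borel_measurable_if_continuous continuous_intros cs cf)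
    show "AE x in lebesgue. (\<lambda>k. D k x) \<longlonglongrightarrow> partial j f x"
    proof (rule AE_I2)
      fix x
      have "((\<lambda>t. (f (x + t *\<^sub>R e) - f x - t *\<^sub>R partial j f x) /\<^sub>R norm t) \<longlongrightarrow> 0) (at 0)"
        using line[of x 0 UNIV] by (simp add: has_vector_derivative_def has_derivative_at_within)
      then have "((\<lambda>t. norm ((1 / t) *\<^sub>R (f (x + t *\<^sub>R e) - f x) - partial j f x)) \<longlongrightarrow> 0) (at 0)"
      proof (rule Lim_transform_eventually[OF tendsto_norm_zero])
        have "norm ((f (x + t *\<^sub>R e) - f x - t *\<^sub>R partial j f x) /\<^sub>R norm t) =
            norm ((1 / t) *\<^sub>R (f (x + t *\<^sub>R e) - f x) - partial j f x)" if "t \<noteq> 0" for t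
        proof -
          have "(1 / t) *\<^sub>R (f (x + t *\<^sub>R e) - f x) - partial j f x =
              (1 / t) *\<^sub>R (f (x + t *\<^sub>R e) - f x - t *\<^sub>R partial j f x)"
            using that by (simp add: scaleR_diff_right)
          then show ?thesis by (simp add: divide_inverse)
        qed
        then show "\<forall>\<^sub>F t in at 0. norm ((f (x + t *\<^sub>R e) - f x - t *\<^sub>R partial j f x) /\<^sub>R norm t) =
            norm ((1 / t) *\<^sub>R (f (x + t *\<^sub>R e) - f x) - partial j f x)"
          by (auto simp: eventually_at_filter)
      qed
      then have "((\<lambda>t. (1 / t) *\<^sub>R (f (x + t *\<^sub>R e) - f x)) \<longlongrightarrow> partial j f x) (at 0)"
        by (rule LIM_zero_cancel[OF tendsto_norm_zero_cancel])
      moreover have "filterlim h (at 0) sequentially"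
        unfolding h_def filterlim_at using LIMSEQ_inverse_real_of_nat by (auto intro!: always_eventually)
      ultimately show "(\<lambda>k. D k x) \<longlonglongrightarrow> partial j f x"
        unfolding D_def by (auto dest: filterlim_compose)
    qed
    show "AE x in lebesgue. norm (D k x) \<le> indicator (cball a (R + 1)) x * M" for k
      using bound by simp
  qed
  then show ?thesis
    by (simp add: int0 LIMSEQ_const_iff)
qed

text \<open>The complement of the closed ball is open, so \<open>f\<close> vanishes in a whole
  neighbourhood of \<open>x\<close>.\<close>

lemma partial_eq_0_outside:
  assumes "\<And>x. x \<notin> cball a R \<Longrightarrow> f x = 0" "x \<notin> cball a R"
  shows "partial j f x = 0"
proof -
  have "((\<lambda>_. 0) has_derivative (\<lambda>_. 0)) (at x)" by simp
  then have "(f has_derivative (\<lambda>_. 0)) (at x)"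
    by (rule has_derivative_transform_within_open[of _ _ _ _ "- cball a R"]) (use assms in auto)
  then show ?thesis by (rule partial_eqI)
qed

text \<open>The product inherits the compact support of \<open>f\<close>, so its partial derivative
  integrates to 0; the product rule splits that integral.\<close>

lemma integral_by_parts:
  fixes f g :: "real^'n::finite \<Rightarrow> 'b::{real_normed_algebra, banach, second_countable_topology}"
  assumes f: "C1 f" and g: "C1 g" and supp: "\<And>x. x \<notin> cball a R \<Longrightarrow> f x = 0"
  shows "(LINT x|lebesgue. f x * partial j g x) = - (LINT x|lebesgue. partial j f x * g x)"
proof -
  have zero: "partial j f x = 0" if "x \<notin> cball a R" for x
    using partial_eq_0_outside[of a R f] supp that by blast
  have "integrable lebesgue (\<lambda>x. f x * partial j g x)"
    by (rule integrable_if_compact_support[of _ a R])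
      (intro continuous_intros C1_continuous_on C1_continuous_on_partial f g, simp add: supp)
  moreover have "integrable lebesgue (\<lambda>x. partial j f x * g x)"
    by (rule integrable_if_compact_support[of _ a R])
      (intro continuous_intros C1_continuous_on C1_continuous_on_partial f g, simp add: zero)
  moreover have "(LINT x|lebesgue. partial j (\<lambda>x. f x * g x) x) = 0"
    by (rule integral_partial_eq_0[OF C1_mult[OF f g], of a R]) (simp add: supp)
  ultimately show ?thesis
    by (simp add: partial_mult[OF f g] add_eq_0_iff)
qed

subsection \<open>Cutoff functions\<close>

text \<open>The translate to the centre \<open>a\<close> of the fixed cutoff \<open>w\<close>. The
  outer square makes the positive part continuously differentiable across the sphere of radius
  \<open>r\<close>.\<close>

definition cutoff :: "real \<Rightarrow> real^'n::finite \<Rightarrow> real^'n \<Rightarrow> real" where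
  "cutoff r a x = (max 0 (r\<^sup>2 - (norm (x - a))\<^sup>2))\<^sup>2"

text \<open>The critical point is \<open>s = 0\<close>, where the difference quotient is at most
  \<open>\<bar>h\<bar>\<close> in absolute value.\<close>

lemma DERIV_max_0_square: "((\<lambda>s. (max 0 s)\<^sup>2) has_real_derivative 2 * max 0 s) (at (s::real))"
proof -
  consider "s < 0" | "s = 0" | "s > 0" by linarith
  then show ?thesis
  proof cases
    case 1
    have "((\<lambda>s. 0) has_real_derivative 2 * max 0 s) (at s)" using 1 by simp
    then show ?thesis
      by (rule DERIV_cong_ev[THEN iffD1, rotated -1, OF _ refl _ refl])
         (use 1 in \<open>auto simp: max_def intro!: eventually_mono[OF eventually_nhds_in_open[of "{..<0}"]]\<close>)
  next
    case 3
    have "((\<lambda>s. s\<^sup>2) has_real_derivative 2 * max 0 s) (at s)"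
      using 3 by (auto intro!: derivative_eq_intros)
    then show ?thesis
      by (rule DERIV_cong_ev[THEN iffD1, rotated -1, OF _ refl _ refl])
         (use 3 in \<open>auto simp: max_def intro!: eventually_mono[OF eventually_nhds_in_open[of "{0<..}"]]\<close>)
  next
    case 2
    have "(\<lambda>h::real. (max 0 h)\<^sup>2 / h) \<midarrow>0\<rightarrow> 0"
    proof (rule Lim_null_comparison)
      have "norm ((max 0 h)\<^sup>2 / h) \<le> \<bar>h\<bar>" for h :: real
        by (auto simp: max_def power2_eq_square)
      then show "\<forall>\<^sub>F h in at 0. norm ((max 0 h)\<^sup>2 / h) \<le> \<bar>h::real\<bar>" by simp
    qed (auto intro!: tendsto_eq_intros)
    then show ?thesis using 2 by (simp add: DERIV_def)
  qed
qed

lemma cutoff_has_derivative: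
  "(cutoff r a has_derivative
    (\<lambda>h. 2 * max 0 (r\<^sup>2 - (norm (x - a))\<^sup>2) * - (2 * ((x - a) \<bullet> h)))) (at x)"
proof -
  have "((\<lambda>x. r\<^sup>2 - (x - a) \<bullet> (x - a)) has_derivative (\<lambda>h. - (2 * ((x - a) \<bullet> h)))) (at x)"
    by (auto intro!: derivative_eq_intros simp: inner_commute)
  from has_derivative_compose[OF this DERIV_max_0_square[unfolded has_field_derivative_def]]
  show ?thesis by (simp add: cutoff_def[abs_def] power2_norm_eq_inner)
qed

lemma C1_cutoff: "C1 (cutoff r a)"
  by (rule C1I[OF cutoff_has_derivative]) (intro continuous_intros)

lemma partial_cutoff:
  "partial j (cutoff r a) x = - 4 * max 0 (r\<^sup>2 - (norm (x - a))\<^sup>2) * (x - a) $ j"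
  using partial_eqI[OF cutoff_has_derivative] by (simp add: inner_axis algebra_simps)

lemma cutoff_eq_0:
  assumes "0 < r" "x \<notin> ball a r"
  shows "cutoff r a x = 0"
proof -
  have "r\<^sup>2 \<le> (norm (x - a))\<^sup>2"
    using assms by (intro power_mono) (auto simp: dist_norm norm_minus_commute)
  then show ?thesis by (simp add: cutoff_def)
qed

lemma cutoff_bounds: "0 \<le> cutoff r a x" "cutoff r a x \<le> r ^ 4"
proof -
  show "0 \<le> cutoff r a x" by (simp add: cutoff_def)
  have "cutoff r a x \<le> (r\<^sup>2)\<^sup>2"
    unfolding cutoff_def by (intro power_mono) auto
  then show "cutoff r a x \<le> r ^ 4" by simp
qed

text \<open>Both integrands depend only on \<open>x - a\<close>. Hence the mass and the gradient
  energy of the cutoffs are the same for all centres.\<close>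

lemma integral_cutoff_shift:
  fixes a :: "real^'n::finite"
  shows "(LINT x|lebesgue. (cutoff r a x)\<^sup>2) = (LINT x|lebesgue. (cutoff r (0 :: real^'n) x)\<^sup>2)"
  "(LINT x|lebesgue. (partial j (cutoff r a) x)\<^sup>2) = (LINT x|lebesgue. (partial j (cutoff r (0 :: real^'n)) x)\<^sup>2)"
proof -
  have "(LINT x|lebesgue. (cutoff r a x)\<^sup>2) = (LINT x|lebesgue. (cutoff r a (x + a))\<^sup>2)"
    by (rule lebesgue_integral_shift[symmetric]) (intro continuous_intros C1_continuous_on C1_cutoff)
  then show "(LINT x|lebesgue. (cutoff r a x)\<^sup>2) = (LINT x|lebesgue. (cutoff r (0 :: real^'n) x)\<^sup>2)"
    by (simp add: cutoff_def)
  have "(LINT x|lebesgue. (partial j (cutoff r a) x)\<^sup>2) = (LINT x|lebesgue. (partial j (cutoff r a) (x + a))\<^sup>2)"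
    by (rule lebesgue_integral_shift[symmetric]) (intro continuous_intros C1_continuous_on_partial C1_cutoff)
  then show "(LINT x|lebesgue. (partial j (cutoff r a) x)\<^sup>2) = (LINT x|lebesgue. (partial j (cutoff r (0 :: real^'n)) x)\<^sup>2)"
    by (simp add: partial_cutoff)
qed

text \<open>A zero integral would make the cutoff vanish almost everywhere; but it is nonzero
  throughout the ball, and a nonempty open set is not negligible.\<close>

lemma integral_cutoff_pos:
  assumes "0 < r"
  shows "0 < (LINT x|lebesgue. (cutoff r (a::real^'n::finite) x)\<^sup>2)"
proof -
  have c: "continuous_on UNIV (\<lambda>x. (cutoff r a x)\<^sup>2)"
    by (intro continuous_intros C1_continuous_on C1_cutoff)
  have "integrable lebesgue (\<lambda>x. (cutoff r a x)\<^sup>2)"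
    by (rule integrable_if_compact_support[OF c, of a r]) (simp add: cutoff_eq_0 assms)
  moreover have "\<not> (AE x in lebesgue. (cutoff r a x)\<^sup>2 = 0)"
  proof
    assume "AE x in lebesgue. (cutoff r a x)\<^sup>2 = 0"
    moreover have "cutoff r a x \<noteq> 0" if "x \<in> ball a r" for x
    proof -
      have "(norm (x - a))\<^sup>2 < r\<^sup>2"
        using that assms by (intro power_strict_mono) (auto simp: dist_norm norm_minus_commute)
      then show ?thesis by (simp add: cutoff_def)
    qed
    ultimately have "AE x in lebesgue. x \<notin> ball a r"
      by (auto elim!: eventually_mono)
    then have "emeasure lebesgue (ball a r) = 0"
      by (subst (asm) AE_iff_measurable[OF _ refl]) (auto simp: ball_def)
    then have "ball a r \<in> null_sets lebesgue" by auto
    then have "negligible (ball a r)" by (simp add: negligible_iff_null_sets)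
    then show False using assms open_not_negligible[of "ball a r"] by simp
  qed
  ultimately show ?thesis
    using integral_nonneg_eq_0_iff_AE[of lebesgue "\<lambda>x. (cutoff r a x)\<^sup>2"]
    by (simp add: less_le)
qed

subsection \<open>Weighted spaces\<close>

text \<open>On a bounded set \<open>\<bar>\<phi>\<bar>\<close> has a bound \<open>M\<close>, so
  \<open>cmod (f x)\<close> is at most 1 plus its square, hence at most 1 plus \<open>exp M\<close>
  times the weighted square.\<close>

lemma L2_set_integrable_bounded:
  fixes f :: "real^'n::finite \<Rightarrow> complex"
  assumes \<phi>: "continuous_on UNIV \<phi>" and f: "f \<in> L2 \<phi>" and B: "bounded B" "B \<in> sets borel"
  shows "set_integrable lebesgue B f"
proof -
  have fm: "f \<in> borel_measurable lebesgue" and fi: "integrable lebesgue (\<lambda>x. (cmod (f x))\<^sup>2 * exp (- \<phi> x))"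
    using f by (auto simp: L2_def)
  have "compact (\<phi> ` closure B)"
    using B by (intro compact_continuous_image continuous_on_subset[OF \<phi>]) auto
  then obtain M where M: "\<And>x. x \<in> B \<Longrightarrow> \<bar>\<phi> x\<bar> \<le> M"
    using closure_subset by (metis compact_imp_bounded bounded_iff imageI real_norm_def subsetD)
  show ?thesis
    unfolding set_integrable_def
  proof (rule Bochner_Integration.integrable_bound)
    show "integrable lebesgue (\<lambda>x. indicator B x + exp M * ((cmod (f x))\<^sup>2 * exp (- \<phi> x)))"
      using B fi by (intro Bochner_Integration.integrable_add integrable_real_indicator integrable_mult_right)
        (auto simp: emeasure_bounded_finite[simplified])
    show "(\<lambda>x. indicator B x *\<^sub>R f x) \<in> borel_measurable lebesgue"
      using fm B by (intro borel_measurable_scaleR borel_measurable_indicator) simp_all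
    have "norm (f x) \<le> 1 + exp M * ((cmod (f x))\<^sup>2 * exp (- \<phi> x))" if "x \<in> B" for x
    proof -
      have "cmod (f x) \<le> 1 + (cmod (f x))\<^sup>2"
        using sum_squares_bound[of 1 "cmod (f x)"] by simp (smt (verit) zero_le_power2)
      moreover have "(cmod (f x))\<^sup>2 * 1 \<le> (cmod (f x))\<^sup>2 * (exp M * exp (- \<phi> x))"
        using M[OF that] by (intro mult_left_mono) (auto simp: exp_add[symmetric])
      ultimately show ?thesis by (simp add: mult_ac)
    qed
    then show "AE x in lebesgue. norm (indicator B x *\<^sub>R f x)
        \<le> norm (indicator B x + exp M * ((cmod (f x))\<^sup>2 * exp (- \<phi> x)))"
      by (intro AE_I2) (auto simp: indicator_def abs_of_nonneg add_nonneg_nonneg)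
  qed
qed

lemma L2_diff:
  assumes "f \<in> L2 \<phi>" "g \<in> L2 \<phi>" "continuous_on UNIV \<phi>"
  shows "(\<lambda>x. f x - g x) \<in> L2 \<phi>"
proof -
  have [measurable]: "f \<in> borel_measurable lebesgue" "g \<in> borel_measurable lebesgue"
      "\<phi> \<in> borel_measurable lebesgue"
    and i: "integrable lebesgue (\<lambda>x. (cmod (f x))\<^sup>2 * exp (- \<phi> x))"
      "integrable lebesgue (\<lambda>x. (cmod (g x))\<^sup>2 * exp (- \<phi> x))"
    using assms borel_measurable_if_continuous by (auto simp: L2_def)
  have "integrable lebesgue (\<lambda>x. (cmod (f x - g x))\<^sup>2 * exp (- \<phi> x))"
  proof (rule Bochner_Integration.integrable_bound)
    show "integrable lebesgue (\<lambda>x. 2 * ((cmod (f x))\<^sup>2 * exp (- \<phi> x)) + 2 * ((cmod (g x))\<^sup>2 * exp (- \<phi> x)))"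
      using i by auto
    have "(cmod (f x - g x))\<^sup>2 * exp (- \<phi> x) \<le>
        2 * ((cmod (f x))\<^sup>2 * exp (- \<phi> x)) + 2 * ((cmod (g x))\<^sup>2 * exp (- \<phi> x))" for x
    proof -
      have "(cmod (f x - g x))\<^sup>2 \<le> (cmod (f x) + cmod (g x))\<^sup>2"
        by (intro power_mono norm_triangle_ineq4) auto
      also have "\<dots> \<le> 2 * (cmod (f x))\<^sup>2 + 2 * (cmod (g x))\<^sup>2"
        using sum_squares_bound[of "cmod (f x)" "cmod (g x)"] by (simp add: power2_sum)
      finally have "(cmod (f x - g x))\<^sup>2 * exp (- \<phi> x)
          \<le> (2 * (cmod (f x))\<^sup>2 + 2 * (cmod (g x))\<^sup>2) * exp (- \<phi> x)"
        by (intro mult_right_mono) auto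
      then show ?thesis by (simp add: algebra_simps)
    qed
    then show "AE x in lebesgue. norm ((cmod (f x - g x))\<^sup>2 * exp (- \<phi> x)) \<le>
        norm (2 * ((cmod (f x))\<^sup>2 * exp (- \<phi> x)) + 2 * ((cmod (g x))\<^sup>2 * exp (- \<phi> x)))"
      by (intro AE_I2) (simp add: abs_of_nonneg add_nonneg_nonneg)
  qed measurable
  then show ?thesis by (simp add: L2_def)
qed

lemma L2_norm_square:
  "(L2_norm \<phi> f)\<^sup>2 = (LINT x|lebesgue. (cmod (f x))\<^sup>2 * exp (- \<phi> x))"
  unfolding L2_norm_def by (rule real_sqrt_pow2) (simp add: integral_nonneg_AE)

text \<open>Both functions are integrable over bounded sets, so the fundamental lemma applies to
  their difference.\<close>

lemma represents_unique:
  fixes \<phi> :: "real^'n::finite \<Rightarrow> real"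
  assumes \<phi>: "continuous_on UNIV \<phi>"
    and f: "f \<in> L2 \<phi>" "represents f T" and g: "g \<in> L2 \<phi>" "represents g T"
  shows "AE x in lebesgue. f x = g x"
proof -
  have loc: "set_integrable lebesgue B f" "set_integrable lebesgue B g"
    if "bounded B" "B \<in> sets borel" for B
    using L2_set_integrable_bounded[OF \<phi>] f g that by auto
  have "AE x in lebesgue. f x - g x = 0"
  proof (rule AE_eq_0_if_test_function_integrals_eq_0)
    show "set_integrable lebesgue (box a b) (\<lambda>x. f x - g x)" for a b
      using loc by (intro set_integral_diff) auto
    fix \<eta> :: "real^'n \<Rightarrow> complex" assume \<eta>: "test_function \<eta>"
    define K where "K = closure {x. \<eta> x \<noteq> 0}"
    have K: "compact K" "bounded K" "K \<in> sets borel"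
      using \<eta> by (auto simp: K_def test_function_def compact_imp_bounded)
    have \<eta>c: "continuous_on S \<eta>" for S
      using \<eta> by (simp add: test_function_def smooth_continuous_on)
    have out: "\<eta> x = 0" if "x \<notin> K" for x
      using that closure_subset by (force simp: K_def)
    have "compact (\<eta> ` K)" using K \<eta>c by (intro compact_continuous_image)
    then obtain M where M: "\<And>x. x \<in> K \<Longrightarrow> norm (\<eta> x) \<le> M"
      by (meson compact_imp_bounded bounded_iff imageI)
    \<comment> \<open>Splitting the integral of the difference needs each product with
      \<open>\<eta>\<close> to be integrable; \<open>\<eta>\<close> is bounded by \<open>M\<close>
      on its compact support \<open>K\<close>.\<close>
    have int: "integrable lebesgue (\<lambda>x. h x * \<eta> x)" if "set_integrable lebesgue K h" for h
    proof (rule Bochner_Integration.integrable_bound)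
      have h: "integrable lebesgue (\<lambda>x. indicator K x *\<^sub>R h x)"
        using that by (simp add: set_integrable_def)
      then show "integrable lebesgue (\<lambda>x. M * norm (indicator K x *\<^sub>R h x))"
        by (intro integrable_mult_right integrable_norm)
      have eq: "h x * \<eta> x = (indicator K x *\<^sub>R h x) * \<eta> x" for x
        using out by (auto simp: indicator_def)
      show "(\<lambda>x. h x * \<eta> x) \<in> borel_measurable lebesgue"
        unfolding eq using h \<eta>c
        by (intro borel_measurable_times borel_measurable_integrable borel_measurable_if_continuous)
      have "norm (h x * \<eta> x) \<le> norm (M * norm (indicator K x *\<^sub>R h x))" for x
      proof (cases "x \<in> K")
        case True
        then have "norm (h x) * norm (\<eta> x) \<le> norm (h x) * \<bar>M\<bar>"
          using M by (intro mult_left_mono) (auto intro: order_trans[OF _ abs_ge_self])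
        then show ?thesis using True by (simp add: norm_mult abs_mult mult.commute)
      qed (simp add: out)
      then show "AE x in lebesgue. norm (h x * \<eta> x) \<le> norm (M * norm (indicator K x *\<^sub>R h x))"
        by simp
    qed
    have "distr_of f \<eta> = distr_of g \<eta>"
      using f g \<eta> by (metis represents_def)
    then show "(LINT x|lebesgue. (f x - g x) * \<eta> x) = 0"
      using int[OF loc(1)[OF K(2,3)]] int[OF loc(2)[OF K(2,3)]]
      by (simp add: distr_of_def left_diff_distrib)
  qed
  then show ?thesis by simp
qed

text \<open>Removes the choice operator from the norm: the chosen representative agrees almost
  everywhere with any explicit one.\<close>

lemma distr_L2_norm_eq:
  fixes \<phi> :: "real^'n::finite \<Rightarrow> real"
  assumes \<phi>: "continuous_on UNIV \<phi>" and g: "g \<in> L2 \<phi>" "represents g T"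
  shows "distr_L2_norm \<phi> T = L2_norm \<phi> g"
proof -
  define h where "h = (SOME g. g \<in> L2 \<phi> \<and> represents g T)"
  have h: "h \<in> L2 \<phi>" "represents h T"
    using someI[of "\<lambda>g. g \<in> L2 \<phi> \<and> represents g T" g] g by (auto simp: h_def)
  have [measurable]: "\<phi> \<in> borel_measurable lebesgue"
    using \<phi> by (rule borel_measurable_if_continuous)
  have "(LINT x|lebesgue. (cmod (h x))\<^sup>2 * exp (- \<phi> x)) = (LINT x|lebesgue. (cmod (g x))\<^sup>2 * exp (- \<phi> x))"
  proof (rule integral_cong_AE)
    show "AE x in lebesgue. (cmod (h x))\<^sup>2 * exp (- \<phi> x) = (cmod (g x))\<^sup>2 * exp (- \<phi> x)"
      using represents_unique[OF \<phi> h g] by (auto elim!: eventually_mono)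
  qed (use g h in \<open>auto simp: L2_def\<close>)
  then show ?thesis
    by (simp add: distr_L2_norm_def h_def[symmetric] L2_norm_def)
qed

subsection \<open>Trial functions\<close>

definition trial :: "(real^'n::finite \<Rightarrow> real) \<Rightarrow> real \<Rightarrow> real^'n \<Rightarrow> real^'n \<Rightarrow> complex" where
  "trial \<phi> r a x = of_real (exp (1/2 * \<phi> x) * cutoff r a x)"

text \<open>The sign \<open>s = 1\<close> gives \<open>\<partial>\<^sub>j\<close> of the trial function and \<open>V1\<close>, the sign \<open>s = - 1\<close> gives
  \<open>X\<^sub>j\<close> and \<open>V2\<close>.\<close>

definition trial_deriv ::
  "(real^'n::finite \<Rightarrow> real) \<Rightarrow> real \<Rightarrow> real \<Rightarrow> real^'n \<Rightarrow> 'n \<Rightarrow> real^'n \<Rightarrow> complex" where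
  "trial_deriv \<phi> s r a j x =
    of_real (exp (1/2 * \<phi> x) * (partial j (cutoff r a) x + s / 2 * partial j \<phi> x * cutoff r a x))"

definition potential :: "real \<Rightarrow> (real^'n::finite \<Rightarrow> real) \<Rightarrow> real^'n \<Rightarrow> real" where
  "potential s \<phi> x = 1/4 * (norm (gradient \<phi> x))\<^sup>2 - s / 2 * laplacian \<phi> x"

lemma V1_eq_potential: "V1 \<phi> = potential 1 \<phi>"
  by (simp add: fun_eq_iff V1_def potential_def)

lemma V2_eq_potential: "V2 \<phi> = potential (- 1) \<phi>"
  by (simp add: fun_eq_iff V2_def potential_def)

lemma potential_eq_sum:
  "potential s \<phi> x = (\<Sum>j\<in>UNIV. 1/4 * (partial j \<phi> x)\<^sup>2 - s / 2 * partial j (partial j \<phi>) x)"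
  by (simp add: potential_def laplacian_def gradient_def norm_vec_def L2_set_def sum_nonneg
      sum_subtractf sum_distrib_left)

lemma continuous_on_potential: "smooth \<phi> \<Longrightarrow> continuous_on S (potential s \<phi>)"
  unfolding potential_eq_sum[abs_def]
  by (intro continuous_intros smooth_continuous_on smooth_partial)

context
  fixes \<phi> :: "real^'n::finite \<Rightarrow> real" and r :: real
  assumes \<phi>: "smooth \<phi>" and r: "0 < r"
begin

text \<open>Multiplication by \<open>exp (\<phi> / 2)\<close> is an isometry from the unweighted to
  the weighted space; this is its pointwise form.\<close>

lemma square_exp_half: "(cmod (of_real (exp (1/2 * \<phi> x) * y)))\<^sup>2 * exp (- \<phi> x) = y\<^sup>2"
proof -
  have "(exp (1/2 * \<phi> x))\<^sup>2 * exp (- \<phi> x) = 1"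
    by (simp add: exp_add[symmetric] power2_eq_square)
  then show ?thesis by (simp add: power_mult_distrib norm_mult algebra_simps)
qed

lemma cutoff_outside:
  assumes "x \<notin> cball a r"
  shows "cutoff r a x = 0" "partial j (cutoff r a) x = 0"
proof -
  have *: "cutoff r a x = 0" if "x \<notin> cball a r" for x
    using that r by (intro cutoff_eq_0) auto
  then show "cutoff r a x = 0" using assms by blast
  show "partial j (cutoff r a) x = 0"
    using partial_eq_0_outside[of a r "cutoff r a"] * assms by blast
qed

lemmas continuity = continuous_intros C1_continuous_on C1_continuous_on_partial C1_cutoff
  C1_if_smooth[OF \<phi>] C1_if_smooth[OF smooth_partial[OF \<phi>]]

lemma L2_if_of_real_exp_half:
  assumes "continuous_on UNIV y" "\<And>x. x \<notin> cball a r \<Longrightarrow> y x = 0"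
  shows "(\<lambda>x. of_real (exp (1/2 * \<phi> x) * y x)) \<in> L2 \<phi>"
    and "(L2_norm \<phi> (\<lambda>x. of_real (exp (1/2 * \<phi> x) * y x)))\<^sup>2 = (LINT x|lebesgue. (y x)\<^sup>2)"
proof -
  have "integrable lebesgue (\<lambda>x. (y x)\<^sup>2)"
    by (rule integrable_if_compact_support[of _ a r]) (use assms in \<open>auto intro!: continuous_intros\<close>)
  moreover have "continuous_on UNIV (\<lambda>x. complex_of_real (exp (1/2 * \<phi> x) * y x))"
    by (intro continuous_intros smooth_continuous_on \<phi> assms)
  ultimately show "(\<lambda>x. of_real (exp (1/2 * \<phi> x) * y x)) \<in> L2 \<phi>"
    unfolding L2_def by (simp only: mem_Collect_eq square_exp_half borel_measurable_if_continuous simp_thms)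
  show "(L2_norm \<phi> (\<lambda>x. of_real (exp (1/2 * \<phi> x) * y x)))\<^sup>2 = (LINT x|lebesgue. (y x)\<^sup>2)"
    unfolding L2_norm_square square_exp_half ..
qed

lemma trial_in_L2: "trial \<phi> r a \<in> L2 \<phi>"
  and trial_norm: "(L2_norm \<phi> (trial \<phi> r a))\<^sup>2 = (LINT x|lebesgue. (cutoff r a x)\<^sup>2)"
  unfolding trial_def[abs_def]
  by (rule L2_if_of_real_exp_half C1_continuous_on C1_cutoff cutoff_outside; assumption?)+

lemma trial_deriv_in_L2: "trial_deriv \<phi> s r a j \<in> L2 \<phi>"
  and trial_deriv_norm: "(L2_norm \<phi> (trial_deriv \<phi> s r a j))\<^sup>2 =
    (LINT x|lebesgue. (partial j (cutoff r a) x + s / 2 * partial j \<phi> x * cutoff r a x)\<^sup>2)"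
proof -
  have c: "continuous_on UNIV (\<lambda>x. partial j (cutoff r a) x + s / 2 * partial j \<phi> x * cutoff r a x)"
    by (intro continuity)
  show "trial_deriv \<phi> s r a j \<in> L2 \<phi>"
    "(L2_norm \<phi> (trial_deriv \<phi> s r a j))\<^sup>2 =
    (LINT x|lebesgue. (partial j (cutoff r a) x + s / 2 * partial j \<phi> x * cutoff r a x)\<^sup>2)"
    unfolding trial_deriv_def[abs_def]
    by (rule L2_if_of_real_exp_half[OF c, of a], simp add: cutoff_outside)+
qed

lemma C1_trial: "C1 (trial \<phi> r a)"
  unfolding trial_def[abs_def]
  by (intro C1_of_real C1_mult C1_exp C1_cutoff C1_if_smooth \<phi>)

lemma partial_trial: "partial j (trial \<phi> r a) x = trial_deriv \<phi> 1 r a j x"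
proof -
  have "partial j (trial \<phi> r a) x = of_real (partial j (\<lambda>x. exp (1/2 * \<phi> x) * cutoff r a x) x)"
    unfolding trial_def[abs_def]
    by (intro partial_of_real C1_mult C1_exp C1_cutoff C1_if_smooth \<phi>)
  also have "partial j (\<lambda>x. exp (1/2 * \<phi> x) * cutoff r a x) x =
      exp (1/2 * \<phi> x) * partial j (cutoff r a) x + 1/2 * partial j \<phi> x * exp (1/2 * \<phi> x) * cutoff r a x"
    unfolding partial_mult[OF C1_exp[OF C1_if_smooth[OF \<phi>]] C1_cutoff] partial_exp[OF C1_if_smooth[OF \<phi>]] ..
  finally show ?thesis
    by (simp add: trial_deriv_def algebra_simps)
qed

lemma trial_outside: "x \<notin> cball a r \<Longrightarrow> trial \<phi> r a x = 0"
  by (simp add: trial_def cutoff_outside)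

section \<open>Distributional derivatives and energy of the trial functions\<close>

text \<open>The trial function is continuously differentiable with compact support, so integration
  by parts identifies its distributional derivative with the classical one.\<close>

lemma represents_trial_partial:
  "represents (trial_deriv \<phi> 1 r a j) (distr_partial j (distr_of (trial \<phi> r a)))"
  unfolding represents_def distr_partial_def distr_of_def
proof (intro allI impI)
  fix \<eta> :: "real^'n \<Rightarrow> complex" assume "test_function \<eta>"
  then have "C1 \<eta>" by (simp add: test_function_def C1_if_smooth)
  then have "(LINT x|lebesgue. trial \<phi> r a x * partial j \<eta> x) =
      - (LINT x|lebesgue. partial j (trial \<phi> r a) x * \<eta> x)"
    by (rule integral_by_parts[OF C1_trial]) (rule trial_outside)
  then show "- (LINT x|lebesgue. trial \<phi> r a x * partial j \<eta> x) = (LINT x|lebesgue. trial_deriv \<phi> 1 r a j x * \<eta> x)"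
    by (simp add: partial_trial)
qed

text \<open>The weight \<open>exp (\<phi> / 2)\<close> contributes
  \<open>1/2 * partial j \<phi>\<close> to the derivative; subtracting
  \<open>partial j \<phi>\<close> turns the coefficient into \<open>- 1/2\<close>, that is,
  \<open>s = 1\<close> into \<open>s = - 1\<close>.\<close>

lemma represents_trial_X:
  "represents (trial_deriv \<phi> (- 1) r a j) (distr_X \<phi> j (distr_of (trial \<phi> r a)))"
  unfolding represents_def
proof (intro allI impI)
  fix \<eta> :: "real^'n \<Rightarrow> complex" assume t: "test_function \<eta>"
  then have \<eta>: "continuous_on UNIV \<eta>" by (simp add: test_function_def smooth_continuous_on)
  have "integrable lebesgue (\<lambda>x. trial_deriv \<phi> 1 r a j x * \<eta> x)"
    by (rule integrable_if_compact_support[of _ a r], unfold trial_deriv_def)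
      (intro continuity \<eta>, simp add: cutoff_outside)
  moreover have "integrable lebesgue (\<lambda>x. trial \<phi> r a x * (of_real (partial j \<phi> x) * \<eta> x))"
    by (rule integrable_if_compact_support[of _ a r])
      (intro continuity C1_trial \<eta>, simp add: trial_outside)
  moreover have "trial_deriv \<phi> (- 1) r a j x * \<eta> x =
      trial_deriv \<phi> 1 r a j x * \<eta> x - trial \<phi> r a x * (of_real (partial j \<phi> x) * \<eta> x)" for x
    by (simp add: trial_deriv_def trial_def algebra_simps)
  ultimately show "distr_X \<phi> j (distr_of (trial \<phi> r a)) \<eta> = distr_of (trial_deriv \<phi> (- 1) r a j) \<eta>"
    using represents_trial_partial[of a j] t
    by (simp add: represents_def distr_X_def distr_mult_def distr_of_def)
qed

text \<open>In the expanded square the mixed term is \<open>s / 2\<close> times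
  \<open>partial j \<phi>\<close> times the derivative of the squared cutoff. Integrating it by
  parts moves the derivative onto \<open>partial j \<phi>\<close> and produces the Laplacian part of
  the potential; \<open>s\<^sup>2 = 1\<close> gives the gradient part its coefficient
  \<open>1/4\<close>.\<close>

lemma sum_trial_deriv_norm:
  assumes s: "s\<^sup>2 = 1"
  shows "(\<Sum>j\<in>UNIV. (L2_norm \<phi> (trial_deriv \<phi> s r a j))\<^sup>2) =
    (\<Sum>j\<in>UNIV. LINT x|lebesgue. (partial j (cutoff r a) x)\<^sup>2) +
    (LINT x|lebesgue. potential s \<phi> x * (cutoff r a x)\<^sup>2)"
proof -
  let ?w = "cutoff r a"
  have int: "integrable lebesgue (\<lambda>x. (1/4 * (partial j \<phi> x)\<^sup>2 - s / 2 * partial j (partial j \<phi>) x) * (?w x)\<^sup>2)" for j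
    by (rule integrable_if_compact_support[of _ a r]) (intro continuity, simp add: cutoff_outside)
  have "(L2_norm \<phi> (trial_deriv \<phi> s r a j))\<^sup>2 = (LINT x|lebesgue. (partial j ?w x)\<^sup>2) +
      (LINT x|lebesgue. (1/4 * (partial j \<phi> x)\<^sup>2 - s / 2 * partial j (partial j \<phi>) x) * (?w x)\<^sup>2)" for j
  proof -
    have w2: "C1 (\<lambda>x. ?w x * ?w x)" by (intro C1_mult C1_cutoff)
    have p: "C1 (partial j \<phi>)" by (rule C1_if_smooth[OF smooth_partial[OF \<phi>]])
    have i1: "integrable lebesgue (\<lambda>x. (partial j ?w x)\<^sup>2)"
      by (rule integrable_if_compact_support[of _ a r]) (intro continuity, simp add: cutoff_outside)
    have i2: "integrable lebesgue (\<lambda>x. s / 2 * (partial j (\<lambda>x. ?w x * ?w x) x * partial j \<phi> x + ?w x * ?w x * partial j (partial j \<phi>) x))"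
      unfolding partial_mult[OF C1_cutoff C1_cutoff]
      by (rule integrable_if_compact_support[of _ a r]) (intro continuity, simp add: cutoff_outside)
    have i3: "integrable lebesgue (\<lambda>x. partial j (\<lambda>x. ?w x * ?w x) x * partial j \<phi> x)"
      unfolding partial_mult[OF C1_cutoff C1_cutoff]
      by (rule integrable_if_compact_support[of _ a r]) (intro continuity, simp add: cutoff_outside)
    have i4: "integrable lebesgue (\<lambda>x. ?w x * ?w x * partial j (partial j \<phi>) x)"
      by (rule integrable_if_compact_support[of _ a r]) (intro continuity, simp add: cutoff_outside)
    have z: "(LINT x|lebesgue. s / 2 * (partial j (\<lambda>x. ?w x * ?w x) x * partial j \<phi> x + ?w x * ?w x * partial j (partial j \<phi>) x)) = 0"
      using integral_by_parts[OF w2 p, of a r j] i3 i4 by (simp add: cutoff_outside)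
    \<comment> \<open>The last summand is \<open>s / 2\<close> times the derivative in direction
      \<open>j\<close> of \<open>(?w x)\<^sup>2 * partial j \<phi> x\<close>, so by \<open>z\<close>
      it integrates to 0.\<close>
    have "(partial j ?w x + s / 2 * partial j \<phi> x * ?w x)\<^sup>2 = (partial j ?w x)\<^sup>2 +
        (1/4 * (partial j \<phi> x)\<^sup>2 - s / 2 * partial j (partial j \<phi>) x) * (?w x)\<^sup>2 +
        s / 2 * (partial j (\<lambda>x. ?w x * ?w x) x * partial j \<phi> x + ?w x * ?w x * partial j (partial j \<phi>) x)" for x
    proof -
      have "(s / 2 * partial j \<phi> x * ?w x)\<^sup>2 = 1/4 * (partial j \<phi> x)\<^sup>2 * (?w x)\<^sup>2"
        using s by (simp add: power_mult_distrib power_divide)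
      then show ?thesis
        unfolding power2_sum partial_mult[OF C1_cutoff C1_cutoff]
        by (simp add: power2_eq_square algebra_simps)
    qed
    then show ?thesis
      unfolding trial_deriv_norm using i1 i2 int[of j] z by simp
  qed
  moreover have "(LINT x|lebesgue. potential s \<phi> x * (?w x)\<^sup>2) =
      (\<Sum>j\<in>UNIV. LINT x|lebesgue. (1/4 * (partial j \<phi> x)\<^sup>2 - s / 2 * partial j (partial j \<phi>) x) * (?w x)\<^sup>2)"
    unfolding potential_eq_sum sum_distrib_right
    by (rule Bochner_Integration.integral_sum) (rule int)
  ultimately show ?thesis
    by (simp only: sum.distrib)
qed

text \<open>The potential may change sign, so the squared cutoff cannot be replaced by its upper
  bound \<open>r ^ 8\<close> directly. Adding \<open>C\<close> first makes the other factor
  nonnegative, at the cost of \<open>C\<close> times the volume of the ball.\<close>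

lemma potential_cutoff_le:
  assumes C: "\<And>x. - C \<le> potential s \<phi> x" "0 < C"
  shows "(LINT x|lebesgue. potential s \<phi> x * (cutoff r a x)\<^sup>2) \<le>
    r ^ 8 * ((LINT x:ball a r|lebesgue. potential s \<phi> x) + C * measure lebesgue (ball a r))"
proof -
  have ind: "integrable lebesgue (\<lambda>x. indicator (ball a r) x * C)"
    by (intro integrable_mult_left integrable_real_indicator)
      (auto simp: emeasure_bounded_finite[simplified])
  have pot: "integrable lebesgue (\<lambda>x. indicator (ball a r) x *\<^sub>R potential s \<phi> x)"
  proof -
    have "integrable lborel (\<lambda>x. indicator (cball a r) x *\<^sub>R potential s \<phi> x)"
      by (intro borel_integrable_compact continuous_on_potential \<phi>) auto
    then have "integrable lebesgue (\<lambda>x. indicator (cball a r) x *\<^sub>R potential s \<phi> x)"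
      using integrable_completion borel_measurable_integrable by metis
    then have "set_integrable lebesgue (ball a r) (potential s \<phi>)"
      unfolding set_integrable_def[symmetric] by (rule set_integrable_subset) auto
    then show ?thesis by (simp add: set_integrable_def)
  qed
  have "(LINT x|lebesgue. potential s \<phi> x * (cutoff r a x)\<^sup>2) \<le>
      (LINT x|lebesgue. r ^ 8 * (indicator (ball a r) x *\<^sub>R potential s \<phi> x + indicator (ball a r) x * C))"
  proof (rule integral_mono)
    show "integrable lebesgue (\<lambda>x. potential s \<phi> x * (cutoff r a x)\<^sup>2)"
      by (rule integrable_if_compact_support[of _ a r])
        (intro continuity continuous_on_potential \<phi>, simp add: cutoff_outside)
    show "integrable lebesgue (\<lambda>x. r ^ 8 * (indicator (ball a r) x *\<^sub>R potential s \<phi> x + indicator (ball a r) x * C))"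
      using ind pot by (intro integrable_mult_right Bochner_Integration.integrable_add)
    fix x
    show "potential s \<phi> x * (cutoff r a x)\<^sup>2 \<le>
        r ^ 8 * (indicator (ball a r) x *\<^sub>R potential s \<phi> x + indicator (ball a r) x * C)"
    proof (cases "x \<in> ball a r")
      case True
      have "(cutoff r a x)\<^sup>2 \<le> (r ^ 4)\<^sup>2"
        using cutoff_bounds by (intro power_mono)
      then have "(potential s \<phi> x + C) * (cutoff r a x)\<^sup>2 \<le> (potential s \<phi> x + C) * r ^ 8"
        using C(1)[of x] by (intro mult_left_mono) auto
      moreover have "potential s \<phi> x * (cutoff r a x)\<^sup>2 \<le> (potential s \<phi> x + C) * (cutoff r a x)\<^sup>2"
        using C(2) by (intro mult_right_mono) auto
      ultimately show ?thesis using True by (simp add: mult.commute)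
    qed (simp add: cutoff_eq_0 r)
  qed
  also have "\<dots> = r ^ 8 * ((LINT x:ball a r|lebesgue. potential s \<phi> x) + C * measure lebesgue (ball a r))"
    using ind pot by (simp add: set_lebesgue_integral_def mult.commute)
  finally show ?thesis .
qed

section \<open>Escape to infinity and conclusion\<close>

text \<open>Trial functions with disjoint supports have squared distance \<open>2 * N\<close>, where
  \<open>N\<close> is their common squared norm, so two of them cannot both be close to
  \<open>v\<close>.\<close>

lemma trial_not_convergent:
  assumes x: "\<And>k. real k \<le> norm (x k)" and s: "strict_mono s" and v: "v \<in> L2 \<phi>"
  shows "\<not> (\<lambda>k. L2_norm \<phi> (\<lambda>y. trial \<phi> r (x (s k)) y - v y)) \<longlonglongrightarrow> 0"
proof
  let ?u = "\<lambda>k. trial \<phi> r (x (s k))"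
  let ?d = "\<lambda>k. (L2_norm \<phi> (\<lambda>y. ?u k y - v y))\<^sup>2"
  define N where "N = (LINT y|lebesgue. (cutoff r (0 :: real^'n) y)\<^sup>2)"
  have N: "0 < N" unfolding N_def by (rule integral_cutoff_pos[OF r])
  assume "(\<lambda>k. L2_norm \<phi> (\<lambda>y. ?u k y - v y)) \<longlonglongrightarrow> 0"
  then have "?d \<longlonglongrightarrow> 0\<^sup>2" by (rule tendsto_power)
  \<comment> \<open>With this threshold \<open>2 * ?d K + 2 * ?d l\<close> stays below
    \<open>N\<close>, whereas disjoint supports force it to be at least
    \<open>2 * N\<close>.\<close>
  then have "\<forall>\<^sub>F k in sequentially. ?d k < N / 4"
    using N by (intro order_tendstoD(2)[of _ "0\<^sup>2"]) auto
  then obtain K where K: "\<And>k. k \<ge> K \<Longrightarrow> ?d k < N / 4"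
    by (auto simp: eventually_sequentially)
  \<comment> \<open>The summand \<open>real K\<close> gives \<open>K \<le> l\<close>; the other two
    put the centre of index \<open>s l\<close> at distance at least \<open>2 * r\<close> from that
    of index \<open>s K\<close>, because its norm is at least \<open>s l\<close> and
    \<open>l \<le> s l\<close>.\<close>
  obtain l where l: "norm (x (s K)) + 2 * r + real K \<le> real l"
    using real_arch_simple by blast
  then have "real K \<le> real l"
    using r norm_ge_zero[of "x (s K)"] by linarith
  then have "K \<le> l" by simp
  have "real l \<le> norm (x (s l))"
    using x[of "s l"] seq_suble[OF s, of l] by linarith
  then have dist: "2 * r \<le> dist (x (s K)) (x (s l))"
    using l norm_triangle_ineq2[of "x (s l)" "x (s K)"]
    by (simp add: dist_norm norm_minus_commute)
  have disj: "?u K y = 0 \<or> ?u l y = 0" for y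
  proof -
    have "y \<notin> ball (x (s K)) r \<or> y \<notin> ball (x (s l)) r"
      using dist dist_triangle2[of "x (s K)" "x (s l)" y] by (auto simp: not_less)
    then show ?thesis using cutoff_eq_0[OF r] by (auto simp: trial_def)
  qed
  let ?e = "\<lambda>f y. (cmod (f y))\<^sup>2 * exp (- \<phi> y)"
  have L2: "?u k \<in> L2 \<phi>" "(\<lambda>y. ?u k y - v y) \<in> L2 \<phi>" for k
    by (intro L2_diff trial_in_L2 v smooth_continuous_on \<phi> r)+
  have int: "integrable lebesgue (?e f)" if "f \<in> L2 \<phi>" for f
    using that by (simp add: L2_def)
  have le: "?e (?u K) y + ?e (?u l) y \<le> 2 * ?e (\<lambda>y. ?u K y - v y) y + 2 * ?e (\<lambda>y. ?u l y - v y) y" for y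
  proof -
    \<comment> \<open>One of the two values is 0, so the sum of squares is the square of the
      difference, into which \<open>v\<close> may be inserted.\<close>
    have "(cmod (?u K y))\<^sup>2 + (cmod (?u l y))\<^sup>2 = (cmod ((?u K y - v y) - (?u l y - v y)))\<^sup>2"
      using disj[of y] by auto
    also have "\<dots> \<le> (cmod (?u K y - v y) + cmod (?u l y - v y))\<^sup>2"
      by (intro power_mono norm_triangle_ineq4) auto
    also have "\<dots> \<le> 2 * (cmod (?u K y - v y))\<^sup>2 + 2 * (cmod (?u l y - v y))\<^sup>2"
      using sum_squares_bound[of "cmod (?u K y - v y)" "cmod (?u l y - v y)"] by (simp add: power2_sum)
    finally have "((cmod (?u K y))\<^sup>2 + (cmod (?u l y))\<^sup>2) * exp (- \<phi> y) \<le>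
        (2 * (cmod (?u K y - v y))\<^sup>2 + 2 * (cmod (?u l y - v y))\<^sup>2) * exp (- \<phi> y)"
      by (intro mult_right_mono) auto
    then show ?thesis by (simp add: algebra_simps)
  qed
  have n: "(LINT y|lebesgue. ?e (?u k) y) = N" for k
    unfolding L2_norm_square[symmetric] trial_norm N_def by (rule integral_cutoff_shift)
  have "N + N = (LINT y|lebesgue. ?e (?u K) y + ?e (?u l) y)"
    using n int[OF L2(1)] by simp
  also have "\<dots> \<le> (LINT y|lebesgue. 2 * ?e (\<lambda>y. ?u K y - v y) y + 2 * ?e (\<lambda>y. ?u l y - v y) y)"
    by (intro integral_mono le Bochner_Integration.integrable_add integrable_mult_right int L2)
  also have "\<dots> = 2 * ?d K + 2 * ?d l"
    unfolding L2_norm_square using int[OF L2(2)] by simp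
  also have "\<dots> < N + N"
    using K[of K] K[OF \<open>K \<le> l\<close>] N by linarith
  finally show False by simp
qed

text \<open>Treats both parts of the theorem at once: \<open>T\<close> is either the distributional
  derivative or \<open>distr_X \<phi>\<close>, and \<open>E\<close> with \<open>nE\<close> becomes
  the matching first-order space and norm.\<close>

lemma potential_integral_tendsto:
  fixes T :: "'n \<Rightarrow> 'n distribution \<Rightarrow> 'n distribution"
  defines "E \<equiv> {f \<in> L2 \<phi>. \<forall>j. distr_in_L2 \<phi> (T j (distr_of f))}"
    and "nE \<equiv> \<lambda>f. sqrt ((L2_norm \<phi> f)\<^sup>2 + (\<Sum>j\<in>UNIV. (distr_L2_norm \<phi> (T j (distr_of f)))\<^sup>2))"
  assumes s: "s\<^sup>2 = 1"
    and T: "\<And>a j. represents (trial_deriv \<phi> s r a j) (T j (distr_of (trial \<phi> r a)))"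
    and C: "0 < C" "\<And>x. - C \<le> potential s \<phi> x"
    and compact: "compact_injection E nE (L2 \<phi>) (L2_norm \<phi>)"
  shows "filterlim (\<lambda>x. LINT y:ball x r|lebesgue. potential s \<phi> y) at_top at_infinity"
proof (rule ccontr)
  assume "\<not> ?thesis"
  \<comment> \<open>Failure of divergence gives a level \<open>Z\<close> that is not reached at
    centres of arbitrarily large norm; taking \<open>b = real k\<close> produces the sequence
    \<open>x\<close>.\<close>
  then obtain Z where "\<forall>b. \<exists>x. b \<le> norm x \<and> (LINT y:ball x r|lebesgue. potential s \<phi> y) < Z"
    unfolding filterlim_at_top eventually_at_infinity by (auto simp: not_le)
  then have "\<forall>k. \<exists>x. real k \<le> norm x \<and> (LINT y:ball x r|lebesgue. potential s \<phi> y) < Z" by blast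
  from choice[OF this] obtain x where x: "\<And>k. real k \<le> norm (x k)"
    and Z: "\<And>k. (LINT y:ball (x k) r|lebesgue. potential s \<phi> y) < Z"
    by blast
  let ?u = "\<lambda>k. trial \<phi> r (x k)"
  have c: "continuous_on UNIV \<phi>" by (rule smooth_continuous_on[OF \<phi>])
  have u: "?u k \<in> E" for k
    unfolding E_def distr_in_L2_def
    using trial_in_L2 trial_deriv_in_L2 T by blast
  \<comment> \<open>\<open>N\<close>, \<open>G\<close> and \<open>P\<close> bound the mass, the
    gradient energy and the potential term of \<open>?u k\<close>. By translation invariance, and by
    the choice of \<open>Z\<close> for the last, none of them depends on \<open>k\<close>.\<close>
  define N where "N = (LINT y|lebesgue. (cutoff r (0 :: real^'n) y)\<^sup>2)"
  define G where "G = (\<Sum>j\<in>UNIV. LINT y|lebesgue. (partial j (cutoff r (0 :: real^'n)) y)\<^sup>2)"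
  define P where "P = r ^ 8 * (Z + C * measure lebesgue (ball (0 :: real^'n) r))"
  have "nE (?u k) \<le> sqrt (N + (G + P))" for k
  proof -
    have "measure lebesgue (ball (x k) r) = measure lebesgue (ball (0 :: real^'n) r)"
      using r by (simp add: content_ball)
    then have "(LINT y|lebesgue. potential s \<phi> y * (cutoff r (x k) y)\<^sup>2) \<le>
        r ^ 8 * ((LINT y:ball (x k) r|lebesgue. potential s \<phi> y) + C * measure lebesgue (ball (0 :: real^'n) r))"
      using potential_cutoff_le[OF C(2,1), of "x k"] by simp
    also have "\<dots> \<le> P"
      unfolding P_def using Z[of k] r by (intro mult_left_mono add_right_mono) auto
    finally have "(LINT y|lebesgue. potential s \<phi> y * (cutoff r (x k) y)\<^sup>2) \<le> P" .
    moreover have "(L2_norm \<phi> (?u k))\<^sup>2 = N"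
      unfolding trial_norm N_def by (rule integral_cutoff_shift)
    moreover have "(\<Sum>j\<in>UNIV. (distr_L2_norm \<phi> (T j (distr_of (?u k))))\<^sup>2) =
        G + (LINT y|lebesgue. potential s \<phi> y * (cutoff r (x k) y)\<^sup>2)"
      unfolding distr_L2_norm_eq[OF c trial_deriv_in_L2 T] sum_trial_deriv_norm[OF s] G_def
      by (intro arg_cong2[of _ _ _ _ "(+)"] sum.cong refl integral_cutoff_shift)
    ultimately show ?thesis unfolding nE_def by simp
  qed
  with u have "(\<forall>k. ?u k \<in> E) \<and> (\<exists>B. \<forall>k. nE (?u k) \<le> B)" by blast
  moreover from compact have "(\<forall>k. ?u k \<in> E) \<and> (\<exists>B. \<forall>k. nE (?u k) \<le> B) \<longrightarrow>
      (\<exists>v\<in>L2 \<phi>. \<exists>t. strict_mono t \<and> (\<lambda>k. L2_norm \<phi> (\<lambda>y. ?u (t k) y - v y)) \<longlonglongrightarrow> 0)"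
    unfolding compact_injection_def by (elim conjE allE[of _ ?u])
  ultimately obtain v t where "v \<in> L2 \<phi>" "strict_mono t"
    "(\<lambda>k. L2_norm \<phi> (\<lambda>y. ?u (t k) y - v y)) \<longlonglongrightarrow> 0"
    by blast
  then show False using trial_not_convergent[of x t v] x by blast
qed

end

theorem corollary1p6:
  fixes \<phi> :: "real^'n::finite \<Rightarrow> real"
  assumes "smooth \<phi>"
  shows "((\<exists>C>0. \<forall>x. V1 \<phi> x \<ge> - C) \<and>
          compact_injection (H1 \<phi>) (H1_norm \<phi>) (L2 \<phi>) (L2_norm \<phi>) \<longrightarrow>
          (\<forall>r>0. filterlim (\<lambda>x. LINT y:ball x r|lebesgue. V1 \<phi> y) at_top at_infinity)) \<and>
         ((\<exists>C>0. \<forall>x. V2 \<phi> x \<ge> - C) \<and>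
          compact_injection (H1X \<phi>) (H1X_norm \<phi>) (L2 \<phi>) (L2_norm \<phi>) \<longrightarrow>
          (\<forall>r>0. filterlim (\<lambda>x. LINT y:ball x r|lebesgue. V2 \<phi> y) at_top at_infinity))"
proof (intro conjI impI allI; elim conjE exE)
  fix r C :: real
  assume r: "0 < r" and C: "0 < C" "\<forall>x. V1 \<phi> x \<ge> - C"
    and K: "compact_injection (H1 \<phi>) (H1_norm \<phi>) (L2 \<phi>) (L2_norm \<phi>)"
  show "filterlim (\<lambda>x. LINT y:ball x r|lebesgue. V1 \<phi> y) at_top at_infinity"
    unfolding V1_eq_potential
    \<comment> \<open>The representation of the distributional derivative instantiates the sign to
      \<open>s = 1\<close>.\<close>
    by (rule potential_integral_tendsto[OF assms r _ represents_trial_partial[OF assms r] C(1)])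
      (use C(2) K in \<open>simp_all add: V1_eq_potential H1_def H1_norm_def[abs_def]\<close>)
next
  fix r C :: real
  assume r: "0 < r" and C: "0 < C" "\<forall>x. V2 \<phi> x \<ge> - C"
    and K: "compact_injection (H1X \<phi>) (H1X_norm \<phi>) (L2 \<phi>) (L2_norm \<phi>)"
  show "filterlim (\<lambda>x. LINT y:ball x r|lebesgue. V2 \<phi> y) at_top at_infinity"
    unfolding V2_eq_potential
    \<comment> \<open>Here the sign becomes \<open>s = - 1\<close>.\<close>
    by (rule potential_integral_tendsto[OF assms r _ represents_trial_X[OF assms r] C(1)])
      (use C(2) K in \<open>simp_all add: V2_eq_potential H1X_def H1X_norm_def[abs_def]\<close>)
qed

end
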